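(* Suppose $d\ge 3$. Let $E\subset\mathbb R^d$ be a compact set with $\dim(E)>\frac{d+2}{2}$. Let $\mu$ be an $s$-Frostman measure on $E$ with $s>\frac{d+2}{2}$. Let $E_1,E_2,E_3$ be pairwise separated compact subsets of $E$ with $\mu(E_i)>0$ for $i=1,2,3$. Then for $\mu_{E_1}\times\mu_{E_2}$-almost every $(x_1,x_2)\in E_1\times E_2$, $$\mathcal L^1\big(\{\mathrm{Area}(x_1,x_2,x_3): x_3\in E_3\}\big)>0.$$
   Context: $\dim$ is Hausdorff dimension and $\mathcal L^1$ is Lebesgue measure on $\mathbb R$. $\mathrm{Area}(x_1,x_2,x_3)$ is the area of the triangle with vertices $x_1,x_2,x_3$. An $s$-Frostman measure on a compact set $E\subset\mathbb R^d$ is a nonzero finite Borel measure $\mu$ supported on $E$ for which there is a constant $C$ with $\mu(B(x,r))\le Cr^s$ for all $x\in\mathbb R^d$, $r>0$. For compact $F\subset E$, $\mu_F$ is the restriction $\mu_F(A)=\mu(A\cap F)$. Sets are pairwise separated if any two are at positive distance. *)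

theory Defs
  imports "HOL-Analysis.Analysis"
begin

text \<open>
  The summand \<open>diam(U)^s\<close> with the usual conventions that the empty set contributes \<open>0\<close>
  and that \<open>0^0 = 1\<close> (in the library, \<open>0 powr 0 = 0\<close>), so that the case \<open>s = 0\<close> is
  counting measure.
\<close>
definition hausdorff_gauge :: "real \<Rightarrow> 'a::metric_space set \<Rightarrow> ennreal" where
  "hausdorff_gauge s U =
     (if U = {} then 0 else if s = 0 then 1 else ennreal (diameter U powr s))"

text \<open>
  Boundedness of the covering sets is required explicitly because \<open>diameter\<close> is real-valued
  and meaningless on unbounded sets.
\<close>
definition hausdorff_premeasure :: "real \<Rightarrow> real \<Rightarrow> 'a::metric_space set \<Rightarrow> ennreal" where
  "hausdorff_premeasure \<delta> s E =
     (INF U \<in> {U :: nat \<Rightarrow> 'a set.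
                 (\<forall>i. bounded (U i) \<and> diameter (U i) \<le> \<delta>) \<and> E \<subseteq> (\<Union>i. U i)}.
        \<Sum>i. hausdorff_gauge s (U i))"

definition hausdorff_measure :: "real \<Rightarrow> 'a::metric_space set \<Rightarrow> ennreal" where
  "hausdorff_measure s E = (SUP \<delta> \<in> {0<..}. hausdorff_premeasure \<delta> s E)"

definition hausdorff_dim :: "'a::metric_space set \<Rightarrow> ereal" where
  "hausdorff_dim E = Inf {ereal s | s. 0 \<le> s \<and> hausdorff_measure s E = 0}"

text \<open>For compact \<open>E\<close>, being supported on \<open>E\<close> means that the complement of \<open>E\<close> is null.\<close>
definition frostman_measure ::
  "real \<Rightarrow> 'a::euclidean_space set \<Rightarrow> 'a measure \<Rightarrow> bool" where
  "frostman_measure s E \<mu> \<longleftrightarrow>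
     sets \<mu> = sets borel \<and> finite_measure \<mu> \<and> emeasure \<mu> UNIV \<noteq> 0 \<and>
     emeasure \<mu> (- E) = 0 \<and>
     (\<exists>C. \<forall>x. \<forall>r>0. measure \<mu> (cball x r) \<le> C * r powr s)"

text \<open>
  The restriction \<open>\<mu>\<^sub>F(A) = \<mu>(A \<inter> F)\<close>, as a measure on the whole space
  (unlike \<open>restrict_space\<close>, whose underlying space is \<open>F\<close>).
\<close>
definition restr_measure :: "'a measure \<Rightarrow> 'a set \<Rightarrow> 'a measure" where
  "restr_measure \<mu> F = density \<mu> (indicator F)"

lemma emeasure_restr_measure:
  assumes "F \<in> sets \<mu>" "A \<in> sets \<mu>"
  shows "emeasure (restr_measure \<mu> F) A = emeasure \<mu> (A \<inter> F)"
  using emeasure_restricted[OF assms] by (simp add: restr_measure_def Int_commute)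

text \<open>
  Half of base times height. If \<open>x1 = x2\<close>, the base has length \<open>0\<close> and so the area is \<open>0\<close>.
\<close>
definition triangle_area :: "'a::euclidean_space \<Rightarrow> 'a \<Rightarrow> 'a \<Rightarrow> real" where
  "triangle_area x1 x2 x3 = dist x1 x2 * infdist x3 (affine hull {x1, x2}) / 2"

lemma triangle_area_gram:
  "triangle_area x1 x2 x3 =
     sqrt ((norm (x2 - x1))\<^sup>2 * (norm (x3 - x1))\<^sup>2 - ((x2 - x1) \<bullet> (x3 - x1))\<^sup>2) / 2"
proof (cases "x1 = x2")
  case True
  then show ?thesis by (simp add: triangle_area_def)
next
  case False
  define u where "u = x2 - x1"
  define v where "v = x3 - x1"
  define t where "t = (u \<bullet> v) / (u \<bullet> u)"
  have u0: "u \<bullet> u > 0" using False by (simp add: u_def)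
  have hull: "affine hull {x1, x2} = range (\<lambda>c. x1 + c *\<^sub>R u)"
    unfolding affine_hull_2_alt u_def ..
  define p where "p = x1 + t *\<^sub>R u"
  have p: "p \<in> affine hull {x1, x2}" unfolding hull p_def by blast
  have perp: "(v - t *\<^sub>R u) \<bullet> u = 0"
    using u0 by (simp add: t_def inner_diff_left inner_commute[of v u])
  have "infdist x3 (affine hull {x1, x2}) = norm (v - t *\<^sub>R u)"
  proof (rule antisym)
    show "infdist x3 (affine hull {x1, x2}) \<le> norm (v - t *\<^sub>R u)"
      using infdist_le[OF p, of x3] by (simp add: p_def v_def dist_norm algebra_simps)
  next
    have "norm (v - t *\<^sub>R u) \<le> dist x3 a" if a: "a \<in> affine hull {x1, x2}" for a
    proof -
      obtain c where c: "a = x1 + c *\<^sub>R u" using a unfolding hull by blast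
      have "x3 - a = (v - t *\<^sub>R u) + (t - c) *\<^sub>R u"
        by (simp add: c v_def algebra_simps)
      moreover have "(norm ((v - t *\<^sub>R u) + (t - c) *\<^sub>R u))\<^sup>2
          = (norm (v - t *\<^sub>R u))\<^sup>2 + (norm ((t - c) *\<^sub>R u))\<^sup>2"
        by (rule norm_add_Pythagorean) (simp add: perp orthogonal_def)
      ultimately have "(norm (v - t *\<^sub>R u))\<^sup>2 \<le> (dist x3 a)\<^sup>2"
        by (simp add: dist_norm)
      then show ?thesis by (rule power2_le_imp_le) simp
    qed
    then show "norm (v - t *\<^sub>R u) \<le> infdist x3 (affine hull {x1, x2})"
      using p by (subst infdist_notempty) (auto intro!: cINF_greatest)
  qed
  moreover have "(norm u * norm (v - t *\<^sub>R u))\<^sup>2 = (norm u)\<^sup>2 * (norm v)\<^sup>2 - (u \<bullet> v)\<^sup>2"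
  proof -
    have N: "(norm (v - t *\<^sub>R u))\<^sup>2 = v \<bullet> v - t * (u \<bullet> v)"
      using perp unfolding power2_norm_eq_inner
      by (simp add: inner_diff_left inner_diff_right inner_commute algebra_simps)
    have "(u \<bullet> u) * (v \<bullet> v - t * (u \<bullet> v)) = (u \<bullet> u) * (v \<bullet> v) - (u \<bullet> v)\<^sup>2"
      using u0 by (simp add: t_def right_diff_distrib power2_eq_square)
    then show ?thesis
      unfolding power_mult_distrib N unfolding power2_norm_eq_inner .
  qed
  then have "norm u * norm (v - t *\<^sub>R u) = sqrt ((norm u)\<^sup>2 * (norm v)\<^sup>2 - (u \<bullet> v)\<^sup>2)"
    by (intro real_sqrt_unique[symmetric]) auto
  ultimately show ?thesis
    by (simp add: triangle_area_def u_def v_def dist_norm norm_minus_commute)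
qed

end

theory Submission
  imports Defs "HOL-Probability.Characteristic_Functions" "HOL-Real_Asymp.Real_Asymp"
begin

text \<open>
  The area of the triangle is a function of the two distances from \<open>x3\<close> to \<open>x1\<close> and \<open>x2\<close>, so it is
  enough that \<open>x3 \<mapsto> (|x3 - x1|^2, |x3 - x2|^2)\<close> maps \<open>E3\<close> onto a set of positive measure in the
  plane; Heron's formula and Fubini then give the areas. Let \<open>\<nu>\<close> be the image of \<open>\<mu>\<close> restricted to
  \<open>E3\<close> under this map. Its Fourier transform at \<open>(a, b)\<close> is the integral of
  \<open>cis (a |x - x1|^2 + b |x - x2|^2)\<close>. If \<open>|b| \<ge> |a|\<close>, fix \<open>x1\<close>: up to a unimodular constant the
  integrand is \<open>f x * cis (-2 b x \<bullet> x2)\<close> with \<open>|f| = 1\<close>, that is, the phase is bilinear in \<open>(x, x2)\<close>.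
  For such phases the Frostman condition on both measures bounds the square of the \<open>L2\<close> norm in \<open>x2\<close>
  by a multiple of \<open>|b| powr (d - 2 s)\<close>. If \<open>|a| \<ge> |b|\<close>, the roles of \<open>x1\<close> and \<open>x2\<close> are exchanged.
  The bound \<open>max |a| |b| powr (d - 2 s)\<close> is integrable at infinity in the plane exactly if
  \<open>2 s - d > 2\<close>, so for almost every \<open>(x1, x2)\<close> the Fourier transform of \<open>\<nu>\<close> is square integrable, and
  then the support of \<open>\<nu>\<close> cannot be a null set.
\<close>

subsection \<open>Gaussian integrals\<close>

text \<open>Rescaling \<open>t\<close> by \<open>sqrt a\<close> turns this into the characteristic
  function of the standard normal distribution.\<close>

lemma gauss_cis_real:
  fixes a x :: real
  assumes "a > 0"
  shows "has_bochner_integral lborel (\<lambda>t. of_real (exp (- a * t\<^sup>2 / 2)) * cis (t * x))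
    (complex_of_real (sqrt (2 * pi / a) * exp (- x\<^sup>2 / (2 * a))))"
proof -
  define r where "r = sqrt a"
  have r: "r > 0" "r\<^sup>2 = a" using assms by (auto simp: r_def)
  define y where "y = x / r"
  have int: "integrable lborel (\<lambda>t. std_normal_density t *\<^sub>R iexp (y * t))"
  proof (rule Bochner_Integration.integrable_bound)
    show "integrable lborel std_normal_density" by simp
    show "AE t in lborel. norm (std_normal_density t *\<^sub>R iexp (y * t)) \<le> norm (std_normal_density t)"
      by simp
  qed simp
  have "(\<integral>t. std_normal_density t *\<^sub>R iexp (y * t) \<partial>lborel) = of_real (exp (- y\<^sup>2 / 2))"
    using fun_cong[OF char_std_normal_distribution, of y]
    unfolding char_def by (subst (asm) integral_density) (auto simp: normal_density_nonneg)
  with int have "has_bochner_integral lborel (\<lambda>t. std_normal_density t *\<^sub>R iexp (y * t)) (of_real (exp (- y\<^sup>2 / 2)))"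
    by (simp add: has_bochner_integral_iff)
  have kern: "complex_of_real (sqrt (2 * pi)) * (std_normal_density t *\<^sub>R iexp (y * t)) =
      of_real (exp (- t\<^sup>2 / 2)) * cis (y * t)" for t
    by (simp add: std_normal_density_def scaleR_conv_of_real cis_conv_exp)
  from has_bochner_integral_mult_right[OF \<open>has_bochner_integral _ _ _\<close>, of "of_real (sqrt (2 * pi))"]
  have "has_bochner_integral lborel (\<lambda>t. of_real (exp (- t\<^sup>2 / 2)) * cis (y * t))
      (of_real (sqrt (2 * pi)) * complex_of_real (exp (- y\<^sup>2 / 2)))"
    unfolding kern .
  from lborel_has_bochner_integral_real_affine_iff[where c=r and t=0 and f="\<lambda>t. of_real (exp (- t\<^sup>2 / 2)) * cis (y * t)", THEN iffD1, OF _ this]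
  have "has_bochner_integral lborel (\<lambda>t. of_real (exp (- (r * t)\<^sup>2 / 2)) * cis (y * (r * t)))
      ((of_real (sqrt (2 * pi)) * complex_of_real (exp (- y\<^sup>2 / 2))) /\<^sub>R r)"
    using r(1) by simp
  moreover have "(r * t)\<^sup>2 = a * t\<^sup>2" "y * (r * t) = t * x" for t
    using r by (auto simp: power_mult_distrib y_def)
  moreover have "(of_real (sqrt (2 * pi)) * complex_of_real (exp (- y\<^sup>2 / 2))) /\<^sub>R r =
      complex_of_real (sqrt (2 * pi / a) * exp (- x\<^sup>2 / (2 * a)))"
    using r by (simp add: scaleR_conv_of_real y_def real_sqrt_divide power_divide r_def field_simps)
  ultimately show ?thesis by (simp only: minus_mult_left[symmetric])
qed

text \<open>The Gaussian and the character both factor over the coordinates, so the integral is a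
  product of one-dimensional ones.\<close>

lemma gauss_cis:
  fixes x :: "'a::euclidean_space"
  assumes "a > 0"
  shows "has_bochner_integral lborel (\<lambda>\<xi>. of_real (exp (- a * (norm \<xi>)\<^sup>2 / 2)) * cis (\<xi> \<bullet> x))
    (complex_of_real (sqrt (2 * pi / a) ^ DIM('a) * exp (- (norm x)\<^sup>2 / (2 * a))))"
proof -
  define h where "h b t = complex_of_real (exp (- a * t\<^sup>2 / 2)) * cis (t * (x \<bullet> b))" for b :: 'a and t
  have h: "has_bochner_integral lborel (h b)
      (complex_of_real (sqrt (2 * pi / a) * exp (- (x \<bullet> b)\<^sup>2 / (2 * a))))" for b
    unfolding h_def by (rule gauss_cis_real[OF assms])
  have hm[measurable]: "h b \<in> borel_measurable borel" for b
    using borel_measurable_has_bochner_integral[OF h[of b]] by simp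
  interpret product_sigma_finite "\<lambda>b::'a. lborel :: real measure" ..
  \<comment> \<open>Lebesgue measure as the image of a product over \<open>Basis\<close>, the form
    in which integrals of products of coordinate functions factor.\<close>
  have L: "(lborel :: 'a measure) = distr (PiM Basis (\<lambda>b. lborel)) borel (\<lambda>f. \<Sum>b\<in>Basis. f b *\<^sub>R b)"
    by (subst lborel_def) (simp only: lborel_eq_real)
  have sq: "(norm y)\<^sup>2 = (\<Sum>b\<in>Basis. (y \<bullet> b)\<^sup>2)" for y :: 'a
    by (subst power2_norm_eq_inner, subst euclidean_inner) (simp add: power2_eq_square)
  have cis_sum: "cis (\<Sum>b\<in>B. u b) = (\<Prod>b\<in>B. cis (u b))" if "finite B" for u and B :: "'a set"
    using that by induction (auto simp: cis_mult[symmetric])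
  have eq: "of_real (exp (- a * (norm \<xi>)\<^sup>2 / 2)) * cis (\<xi> \<bullet> x) = (\<Prod>b\<in>Basis. h b (\<xi> \<bullet> b))" for \<xi> :: 'a
  proof -
    have "exp (- a * (norm \<xi>)\<^sup>2 / 2) = (\<Prod>b\<in>Basis. exp (- a * (\<xi> \<bullet> b)\<^sup>2 / 2))"
      by (simp add: sq exp_sum[symmetric] sum_distrib_left sum_divide_distrib sum_negf)
    moreover have "cis (\<xi> \<bullet> x) = (\<Prod>b\<in>Basis. cis ((\<xi> \<bullet> b) * (x \<bullet> b)))"
      by (subst euclidean_inner) (simp add: cis_sum)
    ultimately show ?thesis by (simp add: h_def prod.distrib)
  qed
  have val: "(\<Prod>b\<in>Basis. complex_of_real (sqrt (2 * pi / a) * exp (- (x \<bullet> b)\<^sup>2 / (2 * a)))) =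
      complex_of_real (sqrt (2 * pi / a) ^ DIM('a) * exp (- (norm x)\<^sup>2 / (2 * a)))"
    by (simp add: prod.distrib sq exp_sum[symmetric] sum_divide_distrib sum_negf
        flip: of_real_prod)
  have 1: "integrable (PiM Basis (\<lambda>b. lborel)) (\<lambda>f. \<Prod>b\<in>(Basis::'a set). h b (f b))"
    using h by (intro product_integrable_prod) (auto simp: has_bochner_integral_iff)
  have 2: "(\<integral>f. (\<Prod>b\<in>(Basis::'a set). h b (f b)) \<partial>PiM Basis (\<lambda>b. lborel)) =
      (\<Prod>b\<in>Basis. complex_of_real (sqrt (2 * pi / a) * exp (- (x \<bullet> b)\<^sup>2 / (2 * a))))"
    using h by (subst product_integral_prod) (auto simp: has_bochner_integral_iff)
  show ?thesis
    unfolding eq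
    unfolding L
    by (subst has_bochner_integral_iff, subst integrable_distr_eq, measurable,
        subst integral_distr, measurable) (use 1 2 val in simp_all)
qed

text \<open>The squared modulus is a double integral over \<open>M\<close> with itself. The Gaussian
  weight makes the whole integrand absolutely integrable, so by Fubini the integral in
  \<open>\<xi>\<close> may be taken first, where \<open>gauss_cis\<close> evaluates it. The identity
  is exact and yields both an upper and a lower bound below.\<close>

lemma gauss_plancherel:
  fixes f :: "'b \<Rightarrow> complex" and g :: "'b \<Rightarrow> 'a::euclidean_space"
  assumes "finite_measure M"
    and [measurable]: "f \<in> borel_measurable M" "g \<in> borel_measurable M"
    and B: "\<And>x. cmod (f x) \<le> B" and a: "a > 0"
  shows "has_bochner_integral lborel
    (\<lambda>\<xi>. exp (- a * (norm \<xi>)\<^sup>2 / 2) * (cmod (\<integral>x. f x * cis (\<xi> \<bullet> g x) \<partial>M))\<^sup>2)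
    (\<integral>p. sqrt (2 * pi / a) ^ DIM('a) * (exp (- (norm (g (fst p) - g (snd p)))\<^sup>2 / (2 * a)) *
       Re (f (fst p) * cnj (f (snd p)))) \<partial>(M \<Otimes>\<^sub>M M))"
proof -
  interpret M: finite_measure M by fact
  interpret MM: finite_measure "M \<Otimes>\<^sub>M M" using assms(1) by (intro finite_measure_pair_measure)
  interpret P: pair_sigma_finite M M ..
  interpret Q: pair_sigma_finite "lborel :: 'a measure" "M \<Otimes>\<^sub>M M" ..
  have [measurable]: "cis \<in> borel_measurable borel" "cnj \<in> borel_measurable borel"
    by (intro borel_measurable_continuous_onI continuous_intros)+
  define G where "G \<xi> = complex_of_real (exp (- a * (norm \<xi>)\<^sup>2 / 2))" for \<xi> :: 'a
  have G[measurable]: "G \<in> borel_measurable borel" unfolding G_def by measurable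
  have Gint: "integrable lborel G"
    using gauss_cis[OF a, of "0::'a"] by (simp add: has_bochner_integral_iff G_def[abs_def])
  define K where "K p = f (fst p) * cnj (f (snd p))" for p
  have K[measurable]: "K \<in> borel_measurable (M \<Otimes>\<^sub>M M)" unfolding K_def by measurable
  have B0: "B \<ge> 0" using B norm_ge_zero order_trans by blast
  have KB: "cmod (K p) \<le> B * B" for p
    unfolding K_def norm_mult complex_mod_cnj by (intro mult_mono B B0 norm_ge_zero)
  define W where "W \<xi> p = G \<xi> * cis (\<xi> \<bullet> (g (fst p) - g (snd p))) * K p" for \<xi> p
  have W[measurable]: "case_prod W \<in> borel_measurable (lborel \<Otimes>\<^sub>M (M \<Otimes>\<^sub>M M))"
    unfolding W_def by measurable
  have Wn: "cmod (W \<xi> p) = cmod (G \<xi>) * cmod (K p)" for \<xi> p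
    by (simp add: W_def norm_mult)
  have Wint1: "integrable (M \<Otimes>\<^sub>M M) (W \<xi>)" for \<xi>
  proof (rule MM.integrable_const_bound[where B="cmod (G \<xi>) * (B*B)"])
    show "AE p in M \<Otimes>\<^sub>M M. cmod (W \<xi> p) \<le> cmod (G \<xi>) * (B * B)"
      unfolding Wn by (intro always_eventually allI mult_left_mono KB norm_ge_zero)
    show "W \<xi> \<in> borel_measurable (M \<Otimes>\<^sub>M M)"
      unfolding W_def[abs_def] by measurable
  qed
  have Wint: "integrable (lborel \<Otimes>\<^sub>M (M \<Otimes>\<^sub>M M)) (case_prod W)"
  proof (rule Q.Fubini_integrable)
    show "integrable lborel (\<lambda>x. \<integral>y. cmod (case (x, y) of (x, xa) \<Rightarrow> W x xa) \<partial>(M \<Otimes>\<^sub>M M))"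
      by (simp add: Wn integrable_norm[OF Gint])
    show "AE x in lborel. complex_integrable (M \<Otimes>\<^sub>M M) (\<lambda>y. case (x, y) of (x, xa) \<Rightarrow> W x xa)"
      using Wint1 by simp
  qed measurable
  have 1: "(\<integral>p. W \<xi> p \<partial>(M \<Otimes>\<^sub>M M)) =
      of_real (exp (- a * (norm \<xi>)\<^sup>2 / 2) * (cmod (\<integral>x. f x * cis (\<xi> \<bullet> g x) \<partial>M))\<^sup>2)" for \<xi>
  proof -
    let ?h = "\<lambda>x. f x * cis (\<xi> \<bullet> g x)"
    have "(\<integral>p. W \<xi> p \<partial>(M \<Otimes>\<^sub>M M)) = (\<integral>p. (case p of (x, y) \<Rightarrow> G \<xi> * (?h x * cnj (?h y))) \<partial>(M \<Otimes>\<^sub>M M))"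
      by (intro Bochner_Integration.integral_cong)
        (auto simp: W_def K_def inner_diff_right cis_cnj cis_mult[symmetric] simp flip: diff_conv_add_uminus
            split: prod.splits simp: cis_divide[symmetric] divide_inverse cis_inverse)
    also have "\<dots> = (\<integral>x. \<integral>y. G \<xi> * (?h x * cnj (?h y)) \<partial>M \<partial>M)"
    proof (rule P.integral_fst[symmetric])
      show "complex_integrable (M \<Otimes>\<^sub>M M) (\<lambda>(x, y). G \<xi> * (?h x * cnj (?h y)))"
      proof (rule MM.integrable_const_bound[where B="cmod (G \<xi>) * (B*B)"])
        show "AE p in M \<Otimes>\<^sub>M M. cmod (case p of (x, y) \<Rightarrow> G \<xi> * (?h x * cnj (?h y))) \<le> cmod (G \<xi>) * (B * B)"
          by (intro always_eventually) (auto simp: norm_mult intro!: mult_left_mono mult_mono B B0)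
      qed measurable
    qed
    also have "\<dots> = G \<xi> * ((\<integral>x. ?h x \<partial>M) * cnj (\<integral>x. ?h x \<partial>M))"
      by (simp add: integral_cnj[symmetric] del: integral_cnj complex_cnj_mult)
    also have "\<dots> = of_real (exp (- a * (norm \<xi>)\<^sup>2 / 2) * (cmod (\<integral>x. ?h x \<partial>M))\<^sup>2)"
      by (simp only: complex_norm_square[symmetric] G_def of_real_mult of_real_power)
    finally show ?thesis .
  qed
  have 2: "(\<integral>\<xi>. W \<xi> p \<partial>lborel) = of_real (sqrt (2 * pi / a) ^ DIM('a) *
       exp (- (norm (g (fst p) - g (snd p)))\<^sup>2 / (2 * a))) * K p" for p
    using gauss_cis[OF a, of "g (fst p) - g (snd p)"]
    by (simp add: W_def G_def has_bochner_integral_iff)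
  have 3: "complex_integrable lborel (\<lambda>\<xi>. \<integral>p. W \<xi> p \<partial>(M \<Otimes>\<^sub>M M))"
    using Q.integrable_fst[OF Wint] by simp
  have 4: "(\<integral>\<xi>. \<integral>p. W \<xi> p \<partial>(M \<Otimes>\<^sub>M M) \<partial>lborel) = (\<integral>p. \<integral>\<xi>. W \<xi> p \<partial>lborel \<partial>(M \<Otimes>\<^sub>M M))"
    using Q.Fubini_integral[OF Wint] by simp
  have 5: "complex_integrable (M \<Otimes>\<^sub>M M) (\<lambda>p. \<integral>\<xi>. W \<xi> p \<partial>lborel)"
    using Q.integrable_snd[OF Wint] by simp
  have "has_bochner_integral lborel (\<lambda>\<xi>. \<integral>p. W \<xi> p \<partial>(M \<Otimes>\<^sub>M M)) (\<integral>p. \<integral>\<xi>. W \<xi> p \<partial>lborel \<partial>(M \<Otimes>\<^sub>M M))"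
    using 3 4 by (simp add: has_bochner_integral_iff)
  \<comment> \<open>By \<open>1\<close> the left integrand is real, so taking real parts loses
    nothing there and leaves \<open>Re\<close> only on the kernel \<open>K\<close>.\<close>
  from has_bochner_integral_Re[OF this]
  have "has_bochner_integral lborel (\<lambda>\<xi>. Re (\<integral>p. W \<xi> p \<partial>(M \<Otimes>\<^sub>M M))) (\<integral>p. Re (\<integral>\<xi>. W \<xi> p \<partial>lborel) \<partial>(M \<Otimes>\<^sub>M M))"
    using integral_Re[OF 5] by simp
  then show ?thesis
    unfolding 1 2 by (simp add: K_def mult.assoc)
qed

lemma nn_integral_eq_has_bochner_integral:
  fixes f :: "'b \<Rightarrow> real"
  assumes "has_bochner_integral M f I" "\<And>x. f x \<ge> 0"
  shows "(\<integral>\<^sup>+x. ennreal (f x) \<partial>M) = ennreal I"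
  using assms by (simp add: has_bochner_integral_iff nn_integral_eq_integral)

text \<open>The phases of \<open>f\<close> are discarded through
  \<open>|Re (f x * cnj (f y))| \<le> B\<^sup>2\<close>, which leaves a Gaussian energy of
  \<open>M\<close> under \<open>g\<close>.\<close>

corollary gauss_plancherel_le:
  fixes f :: "'b \<Rightarrow> complex" and g :: "'b \<Rightarrow> 'a::euclidean_space"
  assumes M: "finite_measure M"
    and [measurable]: "f \<in> borel_measurable M" "g \<in> borel_measurable M"
    and B: "\<And>x. cmod (f x) \<le> B" and a: "a > 0"
  shows "(\<integral>\<^sup>+\<xi>. ennreal (exp (- a * (norm \<xi>)\<^sup>2 / 2) * (cmod (\<integral>x. f x * cis (\<xi> \<bullet> g x) \<partial>M))\<^sup>2) \<partial>lborel)
    \<le> ennreal (sqrt (2 * pi / a) ^ DIM('a) * B\<^sup>2) *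
      (\<integral>\<^sup>+x. \<integral>\<^sup>+y. ennreal (exp (- (norm (g x - g y))\<^sup>2 / (2 * a))) \<partial>M \<partial>M)"
proof -
  interpret M: finite_measure M by fact
  let ?c = "sqrt (2 * pi / a) ^ DIM('a)"
  have "(\<integral>\<^sup>+\<xi>. ennreal (exp (- a * (norm \<xi>)\<^sup>2 / 2) * (cmod (\<integral>x. f x * cis (\<xi> \<bullet> g x) \<partial>M))\<^sup>2) \<partial>lborel)
    = ennreal (\<integral>p. ?c * (exp (- (norm (g (fst p) - g (snd p)))\<^sup>2 / (2 * a)) *
       Re (f (fst p) * cnj (f (snd p)))) \<partial>(M \<Otimes>\<^sub>M M))"
    by (rule nn_integral_eq_has_bochner_integral[OF gauss_plancherel[OF assms]]) simp
  also have "\<dots> \<le> (\<integral>\<^sup>+p. ennreal (norm (?c * (exp (- (norm (g (fst p) - g (snd p)))\<^sup>2 / (2 * a)) *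
       Re (f (fst p) * cnj (f (snd p)))))) \<partial>(M \<Otimes>\<^sub>M M))" (is "ennreal (integral\<^sup>L _ ?h) \<le> _")
  \<comment> \<open>A function that is not integrable has Bochner integral 0 by default, so only the
    integrable case has content.\<close>
  proof (cases "integrable (M \<Otimes>\<^sub>M M) ?h")
    case True
    then show ?thesis
      by (intro order_trans[OF _ integral_norm_bound_ennreal] ennreal_leI) auto
  qed (simp add: not_integrable_integral_eq)
  also have "\<dots> \<le> (\<integral>\<^sup>+p. ennreal (?c * B\<^sup>2) * ennreal (exp (- (norm (g (fst p) - g (snd p)))\<^sup>2 / (2 * a))) \<partial>(M \<Otimes>\<^sub>M M))"
  proof (rule nn_integral_mono)
    fix p :: "'b \<times> 'b"
    have "\<bar>Re (f (fst p) * cnj (f (snd p)))\<bar> \<le> cmod (f (fst p) * cnj (f (snd p)))"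
      by (rule abs_Re_le_cmod)
    also have "\<dots> \<le> B\<^sup>2"
      unfolding norm_mult complex_mod_cnj power2_eq_square
      by (intro mult_mono B norm_ge_zero order_trans[OF norm_ge_zero B])
    finally have *: "\<bar>Re (f (fst p) * cnj (f (snd p)))\<bar> \<le> B\<^sup>2" .
    have "norm (?h p) = (?c * exp (- (norm (g (fst p) - g (snd p)))\<^sup>2 / (2 * a))) * \<bar>Re (f (fst p) * cnj (f (snd p)))\<bar>"
      using a by (simp add: abs_mult)
    also have "\<dots> \<le> (?c * exp (- (norm (g (fst p) - g (snd p)))\<^sup>2 / (2 * a))) * B\<^sup>2"
      using a by (intro mult_left_mono *) simp
    finally show "ennreal (norm (?h p))
        \<le> ennreal (?c * B\<^sup>2) * ennreal (exp (- (norm (g (fst p) - g (snd p)))\<^sup>2 / (2 * a)))"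
      using a by (subst ennreal_mult[symmetric]) (auto intro!: ennreal_leI simp: mult_ac)
  qed
  also have "\<dots> = ennreal (?c * B\<^sup>2) *
      (\<integral>\<^sup>+x. \<integral>\<^sup>+y. ennreal (exp (- (norm (g x - g y))\<^sup>2 / (2 * a))) \<partial>M \<partial>M)"
    by (subst nn_integral_cmult) (simp_all add: M.nn_integral_fst[symmetric])
  finally show ?thesis .
qed

text \<open>The case \<open>f = 1\<close>, where the Gaussian weight, being at most 1, is dropped.
  The bound no longer depends on \<open>a\<close>, so it controls the energy at every scale at
  once.\<close>

corollary gauss_energy:
  fixes g :: "'b \<Rightarrow> 'a::euclidean_space"
  assumes M: "finite_measure M" and [measurable]: "g \<in> borel_measurable M" and a: "a > 0"
  shows "ennreal (sqrt (2 * pi / a) ^ DIM('a)) *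
      (\<integral>\<^sup>+x. \<integral>\<^sup>+y. ennreal (exp (- (norm (g x - g y))\<^sup>2 / (2 * a))) \<partial>M \<partial>M) \<le>
    (\<integral>\<^sup>+\<xi>. ennreal ((cmod (\<integral>x. cis (\<xi> \<bullet> g x) \<partial>M))\<^sup>2) \<partial>lborel)"
proof -
  interpret M: finite_measure M by fact
  interpret MM: finite_measure "M \<Otimes>\<^sub>M M" using assms(1) by (intro finite_measure_pair_measure)
  let ?c = "sqrt (2 * pi / a) ^ DIM('a)"
  let ?e = "\<lambda>p. exp (- (norm (g (fst p) - g (snd p)))\<^sup>2 / (2 * a))"
  have int: "integrable (M \<Otimes>\<^sub>M M) ?e"
    using a by (intro MM.integrable_const_bound[where B=1]) auto
  have "ennreal ?c * (\<integral>\<^sup>+x. \<integral>\<^sup>+y. ennreal (exp (- (norm (g x - g y))\<^sup>2 / (2 * a))) \<partial>M \<partial>M)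
      = ennreal ?c * (\<integral>\<^sup>+p. ennreal (?e p) \<partial>(M \<Otimes>\<^sub>M M))"
    by (simp add: M.nn_integral_fst[symmetric])
  also have "\<dots> = ennreal (\<integral>p. ?c * ?e p \<partial>(M \<Otimes>\<^sub>M M))"
    using int a by (simp add: nn_integral_eq_integral ennreal_mult)
  also have "\<dots> = (\<integral>\<^sup>+\<xi>. ennreal (exp (- a * (norm \<xi>)\<^sup>2 / 2) * (cmod (\<integral>x. cis (\<xi> \<bullet> g x) \<partial>M))\<^sup>2) \<partial>lborel)"
    using nn_integral_eq_has_bochner_integral[OF gauss_plancherel[OF M, of "\<lambda>_. 1" g 1 a]] a
    by simp
  also have "\<dots> \<le> (\<integral>\<^sup>+\<xi>. ennreal ((cmod (\<integral>x. cis (\<xi> \<bullet> g x) \<partial>M))\<^sup>2) \<partial>lborel)"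
    using a by (intro nn_integral_mono ennreal_leI) (simp add: mult_left_le_one_le)
  finally show ?thesis .
qed

subsection \<open>Fourier transforms of Frostman measures\<close>

text \<open>Sum over the shells where \<open>l * norm (x - y)\<close> lies between \<open>n\<close>
  and \<open>n + 1\<close>: the Gaussian decay beats the growth \<open>(n + 1) powr s\<close> of the
  Frostman bound for the ball of radius \<open>(n + 1) / l\<close>, and \<open>l powr (- s)\<close>
  comes out of every term.\<close>

lemma frostman_gauss_bound:
  fixes M :: "'a::euclidean_space measure"
  assumes "finite_measure M" and [measurable_cong]: "sets M = sets borel" and s: "s \<ge> 0"
    and C: "\<And>x r. r > 0 \<Longrightarrow> measure M (cball x r) \<le> C * r powr s"
  obtains A where "A \<ge> 0"
    "\<And>x l. l > 0 \<Longrightarrow> (\<integral>\<^sup>+y. ennreal (exp (- (l * norm (x - y))\<^sup>2 / 4)) \<partial>M) \<le> ennreal (A * l powr (- s))"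
proof -
  interpret finite_measure M by fact
  have C0: "C \<ge> 0" using order_trans[OF measure_nonneg C[of 1 0]] by simp
  \<comment> \<open>The contribution of shell \<open>n\<close>, with \<open>C\<close> and the power
    of \<open>l\<close> taken out.\<close>
  define u where "u n = exp (- (real n)\<^sup>2 / 4) * (real n + 1) powr s" for n
  have u: "summable u"
  proof (rule summable_comparison_test_bigo)
    show "summable (\<lambda>n. norm (1 / real n ^ 2))"
      using inverse_power_summable[of 2, where ?'a=real] by (simp add: divide_inverse)
    show "u \<in> O(\<lambda>n. 1 / real n ^ 2)" unfolding u_def by real_asymp
  qed
  have u0: "u n \<ge> 0" for n by (simp add: u_def)
  show ?thesis
  proof
    show "C * suminf u \<ge> 0" using C0 u u0 by (simp add: suminf_nonneg)
    fix x :: 'a and l :: real assume l: "l > 0"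
    have "(\<integral>\<^sup>+y. ennreal (exp (- (l * norm (x - y))\<^sup>2 / 4)) \<partial>M) \<le>
        (\<integral>\<^sup>+y. (\<Sum>n. ennreal (exp (- (real n)\<^sup>2 / 4)) * indicator (cball x ((real n + 1) / l)) y) \<partial>M)"
    proof (rule nn_integral_mono)
      fix y
      define t where "t = l * norm (x - y)"
      define n where "n = nat \<lfloor>t\<rfloor>"
      have t: "t \<ge> 0" using l by (simp add: t_def)
      then have n: "real n \<le> t" "t \<le> real n + 1"
        by (simp add: n_def) (simp add: n_def, linarith)
      have "y \<in> cball x ((real n + 1) / l)"
        using n l by (simp add: t_def dist_norm field_simps)
      moreover have "exp (- t\<^sup>2 / 4) \<le> exp (- (real n)\<^sup>2 / 4)" using n by simp
      ultimately have "ennreal (exp (- t\<^sup>2 / 4)) \<le> ennreal (exp (- (real n)\<^sup>2 / 4)) * indicator (cball x ((real n + 1) / l)) y"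
        by (simp add: ennreal_leI)
      also have "\<dots> \<le> (\<Sum>n. ennreal (exp (- (real n)\<^sup>2 / 4)) * indicator (cball x ((real n + 1) / l)) y)"
        (is "?f n \<le> suminf ?f")
      proof -
        have "f n \<le> suminf f" for f :: "nat \<Rightarrow> ennreal"
          using sum_le_suminf[OF summableI, of "{n}" f] by simp
        then show ?thesis .
      qed
      finally show "ennreal (exp (- (l * norm (x - y))\<^sup>2 / 4)) \<le> (\<Sum>n. ennreal (exp (- (real n)\<^sup>2 / 4)) * indicator (cball x ((real n + 1) / l)) y)"
        unfolding t_def .
    qed
    also have "\<dots> = (\<Sum>n. ennreal (exp (- (real n)\<^sup>2 / 4)) * emeasure M (cball x ((real n + 1) / l)))"
    proof (subst nn_integral_suminf)
      have [measurable]: "cball x r \<in> sets M" for r using assms(2) by simp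
      show "(\<lambda>y. ennreal (exp (- (real n)\<^sup>2 / 4)) * indicator (cball x ((real n + 1) / l)) y) \<in> borel_measurable M" for n
        by measurable
    qed (use assms(2) in \<open>simp add: nn_integral_cmult_indicator\<close>)
    also have "\<dots> \<le> (\<Sum>n. ennreal (C * l powr (- s) * u n))"
    proof (intro suminf_le summableI)
      fix n
      have "ennreal (exp (- (real n)\<^sup>2 / 4)) * emeasure M (cball x ((real n + 1) / l)) =
          ennreal (exp (- (real n)\<^sup>2 / 4) * measure M (cball x ((real n + 1) / l)))"
        by (simp add: emeasure_eq_measure ennreal_mult)
      also have "\<dots> \<le> ennreal (exp (- (real n)\<^sup>2 / 4) * (C * ((real n + 1) / l) powr s))"
        using l by (intro ennreal_leI mult_left_mono C) auto
      also have "\<dots> = ennreal (C * l powr (- s) * u n)"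
        using l by (simp add: u_def powr_divide powr_minus field_simps)
      finally show "ennreal (exp (- (real n)\<^sup>2 / 4)) * emeasure M (cball x ((real n + 1) / l)) \<le> ennreal (C * l powr (- s) * u n)" .
    qed
    also have "\<dots> = ennreal (C * suminf u * l powr (- s))"
      using C0 u0 u suminf_mult[OF u, of "C * l powr (- s)"] summable_mult[OF u, of "C * l powr (- s)"]
      by (subst suminf_ennreal2) (simp_all add: mult_ac)
    finally show "(\<integral>\<^sup>+y. ennreal (exp (- (l * norm (x - y))\<^sup>2 / 4)) \<partial>M) \<le> ennreal (C * suminf u * l powr (- s))" .
  qed
qed

text \<open>
  The uncertainty principle: if \<open>M\<close> has bounded support, its Fourier transform at one frequency is
  controlled by an average over frequencies at distance about \<open>1\<close>.
\<close>
lemma gauss_locally_constant: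
  fixes M :: "'a::euclidean_space measure"
  assumes "finite_measure M" and [measurable_cong]: "sets M = sets borel"
    and [measurable]: "h \<in> borel_measurable borel" and B: "\<And>x. cmod (h x) \<le> B"
  shows "ennreal ((cmod (\<integral>x. h x * of_real (exp (- (norm x)\<^sup>2 / 2)) \<partial>M))\<^sup>2) \<le>
    (\<integral>\<^sup>+z. ennreal (exp (- (norm z)\<^sup>2 / 2) * (cmod (\<integral>x. h x * cis (z \<bullet> x) \<partial>M))\<^sup>2) \<partial>lborel)"
proof -
  interpret M: finite_measure M by fact
  interpret Q: pair_sigma_finite "lborel :: 'a measure" M ..
  have [measurable]: "cis \<in> borel_measurable borel"
    by (intro borel_measurable_continuous_onI continuous_intros)
  define G where "G z = exp (- (norm z)\<^sup>2 / 2)" for z :: 'a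
  define c where "c = sqrt (2 * pi) ^ DIM('a)"
  have G[measurable]: "G \<in> borel_measurable borel" unfolding G_def by measurable
  have G0: "G z \<ge> 0" for z by (simp add: G_def)
  have gauss: "has_bochner_integral lborel (\<lambda>z. of_real (G z) * cis (z \<bullet> x))
      (complex_of_real (c * exp (- (norm x)\<^sup>2 / 2)))" for x
    using gauss_cis[of 1 x] by (simp add: G_def c_def)
  have Gc: "has_bochner_integral lborel G c"
    using has_bochner_integral_Re[OF gauss[of 0]] by simp
  define P where "P z = (\<integral>x. h x * cis (z \<bullet> x) \<partial>M)" for z
  have P[measurable]: "P \<in> borel_measurable borel" unfolding P_def by measurable
  define W where "W z x = of_real (G z) * (h x * cis (z \<bullet> x))" for z x
  have W[measurable]: "case_prod W \<in> borel_measurable (lborel \<Otimes>\<^sub>M M)"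
    unfolding W_def by measurable
  have hint: "integrable M (\<lambda>x. h x * cis (z \<bullet> x))" for z
    by (rule M.integrable_const_bound[where B=B]) (auto simp: norm_mult B)
  have Wint: "integrable (lborel \<Otimes>\<^sub>M M) (case_prod W)"
  proof (rule Q.Fubini_integrable)
    show "integrable lborel (\<lambda>x. \<integral>y. cmod (case (x, y) of (x, xa) \<Rightarrow> W x xa) \<partial>M)"
      using Gc G0 by (simp add: W_def norm_mult has_bochner_integral_iff)
    show "AE x in lborel. complex_integrable M (\<lambda>y. case (x, y) of (x, xa) \<Rightarrow> W x xa)"
      using hint by (simp add: W_def)
  qed measurable
  \<comment> \<open>Averaging the characters in \<open>P\<close> against \<open>G\<close> reproduces
    the Gaussian in \<open>x\<close>, up to the factor \<open>c\<close>.\<close>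
  have "(\<integral>z. of_real (G z) * P z \<partial>lborel) = (\<integral>z. \<integral>x. W z x \<partial>M \<partial>lborel)"
    using hint by (simp add: W_def P_def)
  also have "\<dots> = (\<integral>x. \<integral>z. W z x \<partial>lborel \<partial>M)"
    by (rule Q.Fubini_integral[OF Wint, symmetric])
  also have "\<dots> = (\<integral>x. of_real c * (h x * of_real (exp (- (norm x)\<^sup>2 / 2))) \<partial>M)"
  proof (rule Bochner_Integration.integral_cong[OF refl])
    fix x
    have "(\<integral>z. W z x \<partial>lborel) = (\<integral>z. h x * (of_real (G z) * cis (z \<bullet> x)) \<partial>lborel)"
      by (simp add: W_def mult_ac)
    also have "\<dots> = h x * complex_of_real (c * exp (- (norm x)\<^sup>2 / 2))"
      using gauss[of x] by (simp add: has_bochner_integral_iff)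
    finally show "(\<integral>z. W z x \<partial>lborel) = of_real c * (h x * of_real (exp (- (norm x)\<^sup>2 / 2)))"
      by (simp add: mult_ac)
  qed
  finally have eq: "(\<integral>z. of_real (G z) * P z \<partial>lborel) =
      of_real c * (\<integral>x. h x * of_real (exp (- (norm x)\<^sup>2 / 2)) \<partial>M)" (is "_ = of_real c * ?I")
    by simp
  \<comment> \<open>The bound \<open>c \<ge> 1\<close> allows \<open>c\<^sup>2\<close> to be lowered
    to \<open>c\<close> at the end, so that one factor \<open>c\<close> cancels and no constant
    remains.\<close>
  have c1: "c \<ge> 1" unfolding c_def using pi_gt3 by (intro one_le_power) (simp add: real_le_rsqrt)
  have GPint: "integrable lborel (\<lambda>z. of_real (G z) * P z)"
    using Q.integrable_fst[OF Wint] hint by (simp add: W_def P_def)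
  have "ennreal (c * cmod ?I) = ennreal (cmod (\<integral>z. of_real (G z) * P z \<partial>lborel))"
    unfolding eq using c1 by (simp add: norm_mult)
  also have "\<dots> \<le> (\<integral>\<^sup>+z. ennreal (cmod (of_real (G z) * P z)) \<partial>lborel)"
    by (rule integral_norm_bound_ennreal[OF GPint])
  \<comment> \<open>Each factor for Cauchy-Schwarz receives half of the weight: one square
    integrates to the total mass \<open>c\<close> of \<open>G\<close>, the other to the weighted
    average of \<open>(cmod (P z))\<^sup>2\<close>.\<close>
  also have "\<dots> = (\<integral>\<^sup>+z. ennreal (sqrt (G z)) * ennreal (sqrt (G z) * cmod (P z)) \<partial>lborel)"
    using G0 by (intro nn_integral_cong) (simp add: norm_mult mult.assoc[symmetric] flip: ennreal_mult)
  finally have "(ennreal (c * cmod ?I))\<^sup>2 \<le> (\<integral>\<^sup>+z. ennreal (sqrt (G z)) * ennreal (sqrt (G z) * cmod (P z)) \<partial>lborel)\<^sup>2"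
    by (rule power_mono) simp
  also have "\<dots> \<le> (\<integral>\<^sup>+z. (ennreal (sqrt (G z)))\<^sup>2 \<partial>lborel) * (\<integral>\<^sup>+z. (ennreal (sqrt (G z) * cmod (P z)))\<^sup>2 \<partial>lborel)"
    by (rule Cauchy_Schwarz_nn_integral) measurable
  also have "(\<integral>\<^sup>+z. (ennreal (sqrt (G z)))\<^sup>2 \<partial>lborel) = (\<integral>\<^sup>+z. ennreal (G z) \<partial>lborel)"
    using G0 by (simp add: ennreal_power)
  also have "\<dots> = ennreal c"
    by (rule nn_integral_eq_has_bochner_integral[OF Gc G0])
  also have "(\<integral>\<^sup>+z. (ennreal (sqrt (G z) * cmod (P z)))\<^sup>2 \<partial>lborel) = (\<integral>\<^sup>+z. ennreal (G z * (cmod (P z))\<^sup>2) \<partial>lborel)"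
    using G0 by (simp add: ennreal_power power_mult_distrib)
  finally have "ennreal (c\<^sup>2 * (cmod ?I)\<^sup>2) \<le> ennreal c * (\<integral>\<^sup>+z. ennreal (G z * (cmod (P z))\<^sup>2) \<partial>lborel)"
    using c1 by (simp add: ennreal_power power_mult_distrib)
  moreover have "ennreal c * ennreal ((cmod ?I)\<^sup>2) \<le> ennreal (c\<^sup>2 * (cmod ?I)\<^sup>2)"
    using c1 by (subst ennreal_mult[symmetric]) (auto intro!: ennreal_leI mult_right_mono self_le_power)
  ultimately have "ennreal c * ennreal ((cmod ?I)\<^sup>2) \<le> ennreal c * (\<integral>\<^sup>+z. ennreal (G z * (cmod (P z))\<^sup>2) \<partial>lborel)"
    by (rule order_trans[rotated])
  then have "ennreal ((cmod ?I)\<^sup>2) \<le> (\<integral>\<^sup>+z. ennreal (G z * (cmod (P z))\<^sup>2) \<partial>lborel)"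
    using c1 by (subst (asm) ennreal_mult_le_mult_iff) auto
  then show ?thesis by (simp add: G_def P_def)
qed

text \<open>By \<open>gauss_locally_constant\<close> the value at frequency
  \<open>l *\<^sub>R y\<close> is replaced by an average of \<open>(cmod (H \<xi>))\<^sup>2\<close>
  nearby. Integrating in \<open>y\<close> first, the Frostman condition on \<open>N\<close> at scale
  \<open>1 / |l|\<close> gives \<open>|l| powr (- s)\<close>. What remains is the square norm of
  \<open>H\<close> over frequencies of size about \<open>|l|\<close>, which Plancherel and the
  Frostman condition on \<open>M\<close> bound by \<open>|l| powr (d - s)\<close>. The constant is
  uniform in \<open>f\<close>, which in the application depends on the other pinned point and on the
  frequency.\<close>

lemma fourier_frostman_L2:
  fixes M N :: "'a::euclidean_space measure"
  assumes M: "finite_measure M" and sM[measurable_cong]: "sets M = sets borel"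
    and N: "finite_measure N" and sN[measurable_cong]: "sets N = sets borel"
    and s: "s \<ge> 0"
    and CM: "\<And>x r. r > 0 \<Longrightarrow> measure M (cball x r) \<le> C * r powr s"
    and CN: "\<And>x r. r > 0 \<Longrightarrow> measure N (cball x r) \<le> C * r powr s"
    and RM: "AE x in M. norm x \<le> R" and RN: "AE x in N. norm x \<le> R"
  obtains K where "K \<ge> 0"
    "\<And>f l. f \<in> borel_measurable borel \<Longrightarrow> (\<And>x. cmod (f x) \<le> 1) \<Longrightarrow> \<bar>l\<bar> \<ge> 1 \<Longrightarrow>
      (\<integral>\<^sup>+y. ennreal ((cmod (\<integral>x. f x * cis (l * (x \<bullet> y)) \<partial>M))\<^sup>2) \<partial>N)
        \<le> ennreal (K * \<bar>l\<bar> powr (real DIM('a) - 2 * s))"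
proof -
  interpret M: finite_measure M by fact
  interpret N: finite_measure N by fact
  have [measurable]: "cis \<in> borel_measurable borel"
    by (intro borel_measurable_continuous_onI continuous_intros)
  have [measurable]: "cball 0 R \<in> sets (borel :: 'a measure)" by simp
  obtain A where A: "A \<ge> 0"
    "\<And>x l. l > 0 \<Longrightarrow> (\<integral>\<^sup>+y. ennreal (exp (- (l * norm (x - y))\<^sup>2 / 4)) \<partial>M) \<le> ennreal (A * l powr (- s))"
    using frostman_gauss_bound[OF M sM s CM] by blast
  obtain A' where A': "A' \<ge> 0"
    "\<And>x l. l > 0 \<Longrightarrow> (\<integral>\<^sup>+y. ennreal (exp (- (l * norm (x - y))\<^sup>2 / 4)) \<partial>N) \<le> ennreal (A' * l powr (- s))"
    using frostman_gauss_bound[OF N sN s CN] by blast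
  define b where "b = exp (R\<^sup>2 / 2)"
  define m where "m = measure M (space M)"
  define K where "K = exp (R\<^sup>2 / 4) * A' * (sqrt (8 * pi) ^ DIM('a) * b\<^sup>2 * A * m)"
  show ?thesis
  proof
    show "K \<ge> 0" using A A' by (simp add: K_def m_def)
    fix f :: "'a \<Rightarrow> complex" and l :: real
    assume f[measurable]: "f \<in> borel_measurable borel" and f1: "\<And>x. cmod (f x) \<le> 1" and l: "\<bar>l\<bar> \<ge> 1"
    define F where "F y = (\<integral>x. f x * cis (l * (x \<bullet> y)) \<partial>M)" for y
    \<comment> \<open>the exponential cancels the Gaussian weight in \<open>gauss_locally_constant\<close>\<close>
    define g where "g x = f x * of_real (exp ((norm x)\<^sup>2 / 2) * indicator (cball 0 R) x)" for x
    have g[measurable]: "g \<in> borel_measurable borel" unfolding g_def by measurable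
    \<comment> \<open>The cutoff, invisible to \<open>M\<close> by \<open>RM\<close>, keeps the
      growing exponential bounded.\<close>
    have gb: "cmod (g x) \<le> b" for x
    proof (cases "norm x \<le> R")
      case True
      then have "cmod (g x) = cmod (f x) * exp ((norm x)\<^sup>2 / 2)"
        by (simp add: g_def norm_mult)
      also have "\<dots> \<le> 1 * b"
        unfolding b_def using True f1[of x] by (intro mult_mono) (auto intro: power_mono)
      finally show ?thesis by simp
    qed (simp add: g_def b_def)
    define H where "H \<xi> = (\<integral>x. g x * cis (\<xi> \<bullet> x) \<partial>M)" for \<xi>
    have H[measurable]: "H \<in> borel_measurable borel" unfolding H_def by measurable
    \<comment> \<open>The character in \<open>y\<close> only shifts the frequency, so the same
      \<open>H\<close> serves for all \<open>y\<close>; translation invariance then recentres the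
      average at \<open>l *\<^sub>R y\<close>.\<close>
    have step1: "ennreal ((cmod (F y))\<^sup>2) \<le>
        (\<integral>\<^sup>+\<xi>. ennreal (exp (- (norm (\<xi> - l *\<^sub>R y))\<^sup>2 / 2) * (cmod (H \<xi>))\<^sup>2) \<partial>lborel)" for y
    proof -
      let ?h = "\<lambda>x. g x * cis (l * (x \<bullet> y))"
      have "F y = (\<integral>x. ?h x * of_real (exp (- (norm x)\<^sup>2 / 2)) \<partial>M)"
        unfolding F_def
      proof (rule integral_cong_AE)
        show "AE x in M. f x * cis (l * (x \<bullet> y)) = ?h x * of_real (exp (- (norm x)\<^sup>2 / 2))"
          using RM
        proof eventually_elim
          case (elim x)
          have "exp ((norm x)\<^sup>2 / 2) * exp (- (norm x)\<^sup>2 / 2) = (1::real)"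
            by (simp flip: exp_add)
          then have "complex_of_real (exp ((norm x)\<^sup>2 / 2)) * of_real (exp (- (norm x)\<^sup>2 / 2)) = 1"
            by (simp only: of_real_mult[symmetric] of_real_1)
          then show ?case using elim by (simp add: g_def)
        qed
      qed measurable
      then have "ennreal ((cmod (F y))\<^sup>2) \<le>
          (\<integral>\<^sup>+z. ennreal (exp (- (norm z)\<^sup>2 / 2) * (cmod (\<integral>x. ?h x * cis (z \<bullet> x) \<partial>M))\<^sup>2) \<partial>lborel)"
        using gauss_locally_constant[OF M sM, of ?h b] gb by (simp add: norm_mult)
      also have "\<dots> = (\<integral>\<^sup>+z. ennreal (exp (- (norm ((l *\<^sub>R y + z) - l *\<^sub>R y))\<^sup>2 / 2) * (cmod (H (l *\<^sub>R y + z)))\<^sup>2) \<partial>lborel)"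
        by (simp add: H_def inner_add_left cis_mult[symmetric] mult.assoc inner_commute[of y])
      also have "\<dots> = (\<integral>\<^sup>+\<xi>. ennreal (exp (- (norm (\<xi> - l *\<^sub>R y))\<^sup>2 / 2) * (cmod (H \<xi>))\<^sup>2) \<partial>distr lborel borel ((+) (l *\<^sub>R y)))"
        by (subst nn_integral_distr) auto
      finally show ?thesis by (simp only: lborel_distr_plus)
    qed
    \<comment> \<open>Half of the exponent is kept for the integral in \<open>y\<close>. With
      \<open>w = norm (\<xi> - l *\<^sub>R y)\<close>, the inequality \<open>(norm \<xi>)\<^sup>2
      \<le> 2 * w\<^sup>2 + 2 * (l\<^sup>2 * R\<^sup>2)\<close> trades the other half for a Gaussian
      in \<open>\<xi>\<close> of width about \<open>|l|\<close>, at the price of a constant.\<close>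
    have step2: "exp (- (norm (\<xi> - l *\<^sub>R y))\<^sup>2 / 2) \<le>
        exp (R\<^sup>2 / 4) * exp (- (1 / (4 * l\<^sup>2)) * (norm \<xi>)\<^sup>2 / 2) * exp (- (\<bar>l\<bar> * norm (\<xi> /\<^sub>R l - y))\<^sup>2 / 4)"
      if y: "norm y \<le> R" for \<xi> y
    proof -
      define w where "w = norm (\<xi> - l *\<^sub>R y)"
      have l2: "l\<^sup>2 \<ge> 1" using l by (simp add: abs_le_square_iff[of 1, simplified])
      have "\<bar>l\<bar> * norm (\<xi> /\<^sub>R l - y) = norm (l *\<^sub>R (\<xi> /\<^sub>R l - y))" by simp
      also have "l *\<^sub>R (\<xi> /\<^sub>R l - y) = \<xi> - l *\<^sub>R y"
        using l by (auto simp: algebra_simps)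
      finally have 1: "\<bar>l\<bar> * norm (\<xi> /\<^sub>R l - y) = w" by (simp add: w_def)
      have "norm \<xi> \<le> w + norm (l *\<^sub>R y)"
        unfolding w_def by (metis add.commute norm_triangle_sub)
      then have "norm \<xi> \<le> w + \<bar>l\<bar> * R"
        using y l mult_left_mono[OF y, of "\<bar>l\<bar>"] by simp
      then have "(norm \<xi>)\<^sup>2 \<le> (w + \<bar>l\<bar> * R)\<^sup>2" by (intro power_mono) auto
      also have "\<dots> \<le> 2 * w\<^sup>2 + 2 * (l\<^sup>2 * R\<^sup>2)"
        using zero_le_power2[of "w - \<bar>l\<bar> * R"] by (simp add: power2_eq_square algebra_simps)
      finally have "(norm \<xi>)\<^sup>2 / (8 * l\<^sup>2) \<le> (2 * w\<^sup>2 + 2 * (l\<^sup>2 * R\<^sup>2)) / (8 * l\<^sup>2)"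
        using l2 by (intro divide_right_mono) auto
      also have "\<dots> = w\<^sup>2 / (4 * l\<^sup>2) + R\<^sup>2 / 4"
        using l by (auto simp: field_simps)
      also have "w\<^sup>2 / (4 * l\<^sup>2) \<le> w\<^sup>2 / 4"
        using l2 by (intro divide_left_mono) auto
      finally have "- w\<^sup>2 / 2 \<le> R\<^sup>2 / 4 + (- (1 / (4 * l\<^sup>2)) * (norm \<xi>)\<^sup>2 / 2) + (- w\<^sup>2 / 4)"
        by simp
      then have "exp (- w\<^sup>2 / 2) \<le> exp (R\<^sup>2 / 4 + (- (1 / (4 * l\<^sup>2)) * (norm \<xi>)\<^sup>2 / 2) + (- w\<^sup>2 / 4))"
        by (simp only: exp_le_cancel_iff)
      then show ?thesis unfolding 1 by (simp only: exp_add w_def)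
    qed
    let ?G = "\<lambda>\<xi>. exp (- (1 / (4 * l\<^sup>2)) * (norm \<xi>)\<^sup>2 / 2) * (cmod (H \<xi>))\<^sup>2"
    let ?E = "\<lambda>\<xi> y. exp (- (\<bar>l\<bar> * norm (\<xi> /\<^sub>R l - y))\<^sup>2 / 4)"
    have "(\<integral>\<^sup>+y. ennreal ((cmod (F y))\<^sup>2) \<partial>N) \<le>
        (\<integral>\<^sup>+y. \<integral>\<^sup>+\<xi>. ennreal (exp (R\<^sup>2 / 4) * ?G \<xi>) * ennreal (?E \<xi> y) \<partial>lborel \<partial>N)"
      using RN
    proof (intro nn_integral_mono_AE, eventually_elim)
      case (elim y)
      show ?case
      proof (rule order_trans[OF step1 nn_integral_mono])
        fix \<xi>
        have "exp (- (norm (\<xi> - l *\<^sub>R y))\<^sup>2 / 2) * (cmod (H \<xi>))\<^sup>2 \<le> exp (R\<^sup>2 / 4) * ?G \<xi> * ?E \<xi> y"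
          using mult_right_mono[OF step2[OF elim(2), of \<xi>], of "(cmod (H \<xi>))\<^sup>2"] by (simp add: mult_ac)
        then show "ennreal (exp (- (norm (\<xi> - l *\<^sub>R y))\<^sup>2 / 2) * (cmod (H \<xi>))\<^sup>2)
            \<le> ennreal (exp (R\<^sup>2 / 4) * ?G \<xi>) * ennreal (?E \<xi> y)"
          by (subst ennreal_mult[symmetric]) (auto intro: ennreal_leI)
      qed
    qed
    also have "\<dots> = (\<integral>\<^sup>+\<xi>. \<integral>\<^sup>+y. ennreal (exp (R\<^sup>2 / 4) * ?G \<xi>) * ennreal (?E \<xi> y) \<partial>N \<partial>lborel)"
    proof -
      interpret pair_sigma_finite "lborel :: 'a measure" N ..
      show ?thesis by (rule Fubini') measurable
    qed
    also have "\<dots> = (\<integral>\<^sup>+\<xi>. ennreal (exp (R\<^sup>2 / 4) * ?G \<xi>) * (\<integral>\<^sup>+y. ennreal (?E \<xi> y) \<partial>N) \<partial>lborel)"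
      by (intro nn_integral_cong nn_integral_cmult) measurable
    \<comment> \<open>The Frostman bound for \<open>N\<close> around the centre
      \<open>\<xi> /\<^sub>R l\<close>, uniform in \<open>\<xi>\<close>.\<close>
    also have "\<dots> \<le> (\<integral>\<^sup>+\<xi>. ennreal (exp (R\<^sup>2 / 4) * ?G \<xi>) * ennreal (A' * \<bar>l\<bar> powr (- s)) \<partial>lborel)"
      using l by (intro nn_integral_mono mult_left_mono A'(2)) auto
    also have "\<dots> = (\<integral>\<^sup>+\<xi>. ennreal (exp (R\<^sup>2 / 4) * A' * \<bar>l\<bar> powr (- s)) * ennreal (?G \<xi>) \<partial>lborel)"
      using A'(1) by (intro nn_integral_cong) (simp add: mult_ac flip: ennreal_mult)
    also have "\<dots> = ennreal (exp (R\<^sup>2 / 4) * A' * \<bar>l\<bar> powr (- s)) * (\<integral>\<^sup>+\<xi>. ennreal (?G \<xi>) \<partial>lborel)"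
      by (rule nn_integral_cmult) measurable
    also have "(\<integral>\<^sup>+\<xi>. ennreal (?G \<xi>) \<partial>lborel) \<le> ennreal (sqrt (2 * pi / (1 / (4 * l\<^sup>2))) ^ DIM('a) * b\<^sup>2) *
        (\<integral>\<^sup>+x. \<integral>\<^sup>+y. ennreal (exp (- (norm (x - y))\<^sup>2 / (2 * (1 / (4 * l\<^sup>2))))) \<partial>M \<partial>M)"
      unfolding H_def
      using l by (intro gauss_plancherel_le[OF M, where g="\<lambda>x. x"] gb) auto
    \<comment> \<open>The width \<open>a = 1 / (4 * l\<^sup>2)\<close> yields one factor
      \<open>|l|\<close> per dimension.\<close>
    also have "sqrt (2 * pi / (1 / (4 * l\<^sup>2))) = sqrt (8 * pi) * \<bar>l\<bar>"
      by (simp add: real_sqrt_mult)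
    also have "(\<integral>\<^sup>+x. \<integral>\<^sup>+y. ennreal (exp (- (norm (x - y))\<^sup>2 / (2 * (1 / (4 * l\<^sup>2))))) \<partial>M \<partial>M)
        \<le> (\<integral>\<^sup>+x. ennreal (A * \<bar>l\<bar> powr (- s)) \<partial>M)"
    proof (rule nn_integral_mono)
      fix x :: 'a
      \<comment> \<open>The exponent on the left is
        \<open>- 2 * l\<^sup>2 * (norm (x - y))\<^sup>2\<close>, so the slower decay in the bound
        for \<open>A\<close> suffices.\<close>
      have "(\<integral>\<^sup>+y. ennreal (exp (- (norm (x - y))\<^sup>2 / (2 * (1 / (4 * l\<^sup>2))))) \<partial>M) \<le>
          (\<integral>\<^sup>+y. ennreal (exp (- (\<bar>l\<bar> * norm (x - y))\<^sup>2 / 4)) \<partial>M)"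
        using l by (intro nn_integral_mono ennreal_leI) (simp add: power_mult_distrib)
      also have "\<dots> \<le> ennreal (A * \<bar>l\<bar> powr (- s))" using l by (intro A) auto
      finally show "(\<integral>\<^sup>+y. ennreal (exp (- (norm (x - y))\<^sup>2 / (2 * (1 / (4 * l\<^sup>2))))) \<partial>M) \<le> ennreal (A * \<bar>l\<bar> powr (- s))" .
    qed
    also have "(\<integral>\<^sup>+x. ennreal (A * \<bar>l\<bar> powr (- s)) \<partial>M) = ennreal (A * \<bar>l\<bar> powr (- s) * m)"
      using A(1) by (simp add: M.emeasure_eq_measure m_def ennreal_mult)
    also have "ennreal (exp (R\<^sup>2 / 4) * A' * \<bar>l\<bar> powr (- s)) *
        (ennreal ((sqrt (8 * pi) * \<bar>l\<bar>) ^ DIM('a) * b\<^sup>2) * ennreal (A * \<bar>l\<bar> powr (- s) * m)) =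
        ennreal (K * (\<bar>l\<bar> powr (- s) * \<bar>l\<bar> ^ DIM('a) * \<bar>l\<bar> powr (- s)))"
      using A A' by (simp add: K_def power_mult_distrib m_def mult_ac flip: ennreal_mult)
    also have "\<bar>l\<bar> powr (- s) * \<bar>l\<bar> ^ DIM('a) * \<bar>l\<bar> powr (- s) = \<bar>l\<bar> powr (real DIM('a) - 2 * s)"
      using l by (subst powr_realpow[symmetric]) (auto simp: powr_add[symmetric])
    finally show "(\<integral>\<^sup>+y. ennreal ((cmod (\<integral>x. f x * cis (l * (x \<bullet> y)) \<partial>M))\<^sup>2) \<partial>N)
        \<le> ennreal (K * \<bar>l\<bar> powr (real DIM('a) - 2 * s))"
      by (simp add: F_def mult_left_mono)
  qed
qed

subsection \<open>Pinned pairs of distances\<close>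

lemma nn_integral_powr_tail_finite:
  fixes q :: real
  assumes q: "q > 1"
  shows "(\<integral>\<^sup>+t. ennreal ((1 + \<bar>t\<bar>) powr (- q)) \<partial>lborel) < \<infinity>"
proof -
  let ?g = "\<lambda>t::real. ennreal ((1 + t) powr (- q)) * indicator {0..} t"
  have "(\<integral>\<^sup>+t. ?g t \<partial>lborel) = ennreal (0 - (1 + 0) powr (1 - q) / (1 - q))"
  proof (rule nn_integral_FTC_atLeast)
    show "((\<lambda>t. (1 + t) powr (1 - q) / (1 - q)) has_real_derivative (1 + t) powr (- q)) (at t)" if "0 \<le> t" for t
    proof -
      have "((\<lambda>t. (1 + t) powr (1 - q)) has_real_derivative (1 - q) * (1 + t) powr (1 - q - 1)) (at t)"
        using that by (auto intro!: derivative_eq_intros)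
      from DERIV_cdivide[OF this, of "1 - q"] show ?thesis using q by simp
    qed
    show "((\<lambda>t. (1 + t) powr (1 - q) / (1 - q)) \<longlongrightarrow> 0) at_top"
      using q by real_asymp
  qed auto
  then have fin: "(\<integral>\<^sup>+t. ?g t \<partial>lborel) < \<infinity>" by simp
  have refl: "(\<integral>\<^sup>+t. ?g t \<partial>lborel) = (\<integral>\<^sup>+t. ?g (- t) \<partial>lborel)"
    using nn_integral_real_affine[of ?g "-1" 0] by simp
  have "(\<integral>\<^sup>+t. ennreal ((1 + \<bar>t\<bar>) powr (- q)) \<partial>lborel) \<le> (\<integral>\<^sup>+t. ?g t + ?g (- t) \<partial>lborel)"
    by (intro nn_integral_mono) (auto simp: abs_if split: split_indicator)
  also have "\<dots> = (\<integral>\<^sup>+t. ?g t \<partial>lborel) + (\<integral>\<^sup>+t. ?g (- t) \<partial>lborel)"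
    by (rule nn_integral_add) measurable
  also have "\<dots> < \<infinity>" using fin refl by simp
  finally show ?thesis .
qed

text \<open>Finiteness almost everywhere follows from finiteness of the integral over all pairs.
  Tonelli then allows each frequency \<open>(a, b)\<close> to be treated separately, averaging first
  over the pinned point that belongs to the larger of \<open>|a|\<close> and
  \<open>|b|\<close>.\<close>

lemma pinned_distances_fourier_L2:
  fixes M1 M2 M3 :: "'a::euclidean_space measure"
  assumes M1: "finite_measure M1" and s1[measurable_cong]: "sets M1 = sets borel"
    and M2: "finite_measure M2" and s2[measurable_cong]: "sets M2 = sets borel"
    and M3: "finite_measure M3" and s3[measurable_cong]: "sets M3 = sets borel"
    and s: "s > (real DIM('a) + 2) / 2"
    and C1: "\<And>x r. r > 0 \<Longrightarrow> measure M1 (cball x r) \<le> C * r powr s"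
    and C2: "\<And>x r. r > 0 \<Longrightarrow> measure M2 (cball x r) \<le> C * r powr s"
    and C3: "\<And>x r. r > 0 \<Longrightarrow> measure M3 (cball x r) \<le> C * r powr s"
    and R1: "AE x in M1. norm x \<le> R" and R2: "AE x in M2. norm x \<le> R" and R3: "AE x in M3. norm x \<le> R"
  shows "AE (x1, x2) in M1 \<Otimes>\<^sub>M M2.
    (\<integral>\<^sup>+\<zeta>. ennreal ((cmod (\<integral>x. cis (\<zeta> \<bullet> ((norm (x - x1))\<^sup>2, (norm (x - x2))\<^sup>2)) \<partial>M3))\<^sup>2) \<partial>lborel) < \<infinity>"
proof -
  interpret M1: finite_measure M1 by fact
  interpret M2: finite_measure M2 by fact
  interpret M3: finite_measure M3 by fact
  interpret P: pair_sigma_finite M1 M2 ..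
  interpret Q: pair_sigma_finite "lborel :: (real \<times> real) measure" "M1 \<Otimes>\<^sub>M M2" ..
  have [measurable]: "cis \<in> borel_measurable borel"
    by (intro borel_measurable_continuous_onI continuous_intros)
  define p where "p = 2 * s - real DIM('a)"
  have p: "p > 2" using s by (simp add: p_def)
  have s0: "s \<ge> 0" using s by (smt (verit) divide_nonneg_nonneg of_nat_0_le_iff)
  define \<Phi> where "\<Phi> a b x1 x2 = ennreal ((cmod (\<integral>x. cis (a * (norm (x - x1))\<^sup>2 + b * (norm (x - x2))\<^sup>2) \<partial>M3))\<^sup>2)" for a b x1 x2
  have \<Phi>[measurable]: "(\<lambda>w. \<Phi> (fst (fst w)) (snd (fst w)) (fst (snd w)) (snd (snd w))) \<in>
      borel_measurable (lborel \<Otimes>\<^sub>M (M1 \<Otimes>\<^sub>M M2))"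
  proof -
    let ?T = "\<lambda>q :: ((real \<times> real) \<times> 'a \<times> 'a) \<times> 'a. cis (fst (fst (fst q)) * (norm (snd q - fst (snd (fst q))))\<^sup>2 +
        snd (fst (fst q)) * (norm (snd q - snd (snd (fst q))))\<^sup>2)"
    \<comment> \<open>The integrand is jointly continuous, so joint measurability only needs the
      product sigma-algebra to be the Borel one.\<close>
    have "sets ((lborel \<Otimes>\<^sub>M (M1 \<Otimes>\<^sub>M M2)) \<Otimes>\<^sub>M M3) =
        sets ((borel \<Otimes>\<^sub>M (borel \<Otimes>\<^sub>M borel)) \<Otimes>\<^sub>M borel :: (((real \<times> real) \<times> 'a \<times> 'a) \<times> 'a) measure)"
      by (intro sets_pair_measure_cong s1 s2 s3 sets_lborel)
    then have sets_eq: "sets ((lborel \<Otimes>\<^sub>M (M1 \<Otimes>\<^sub>M M2)) \<Otimes>\<^sub>M M3) =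
        sets (borel :: (((real \<times> real) \<times> 'a \<times> 'a) \<times> 'a) measure)"
      by (simp only: borel_prod)
    have "?T \<in> borel_measurable borel"
      by (intro borel_measurable_continuous_onI continuous_intros)
    then have [measurable]: "?T \<in> borel_measurable ((lborel \<Otimes>\<^sub>M (M1 \<Otimes>\<^sub>M M2)) \<Otimes>\<^sub>M M3)"
      unfolding measurable_cong_sets[OF sets_eq refl] .
    have "(\<lambda>w. \<integral>x. ?T (w, x) \<partial>M3) \<in> borel_measurable (lborel \<Otimes>\<^sub>M (M1 \<Otimes>\<^sub>M M2))"
      by (rule M3.borel_measurable_lebesgue_integral) (simp add: split_beta')
    then show ?thesis unfolding \<Phi>_def by simp
  qed
  have \<Phi>z[measurable]: "(\<lambda>z. \<Phi> a b (fst z) (snd z)) \<in> borel_measurable (M1 \<Otimes>\<^sub>M M2)" for a b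
    using measurable_compose[OF measurable_Pair1'[of "(a, b)" lborel "M1 \<Otimes>\<^sub>M M2"] \<Phi>] by simp
  define m1 m2 m3 where "m1 = measure M1 (space M1)" and "m2 = measure M2 (space M2)" and "m3 = measure M3 (space M3)"
  have m: "m1 \<ge> 0" "m2 \<ge> 0" "m3 \<ge> 0" by (simp_all add: m1_def m2_def m3_def)
  obtain K2 where K2: "K2 \<ge> 0"
    "\<And>f l. f \<in> borel_measurable borel \<Longrightarrow> (\<And>x. cmod (f x) \<le> 1) \<Longrightarrow> \<bar>l\<bar> \<ge> 1 \<Longrightarrow>
      (\<integral>\<^sup>+y. ennreal ((cmod (\<integral>x. f x * cis (l * (x \<bullet> y)) \<partial>M3))\<^sup>2) \<partial>M2)
        \<le> ennreal (K2 * \<bar>l\<bar> powr (real DIM('a) - 2 * s))"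
    using fourier_frostman_L2[OF M3 s3 M2 s2 s0 C3 C2 R3 R2] by blast
  obtain K1 where K1: "K1 \<ge> 0"
    "\<And>f l. f \<in> borel_measurable borel \<Longrightarrow> (\<And>x. cmod (f x) \<le> 1) \<Longrightarrow> \<bar>l\<bar> \<ge> 1 \<Longrightarrow>
      (\<integral>\<^sup>+y. ennreal ((cmod (\<integral>x. f x * cis (l * (x \<bullet> y)) \<partial>M3))\<^sup>2) \<partial>M1)
        \<le> ennreal (K1 * \<bar>l\<bar> powr (real DIM('a) - 2 * s))"
    using fourier_frostman_L2[OF M3 s3 M1 s1 s0 C3 C1 R3 R1] by blast
  \<comment> \<open>The phase \<open>t\<close> is arbitrary, so one identity serves for both pinned
    points.\<close>
  have linearize: "cmod (\<integral>x. cis (t x + b * (norm (x - y))\<^sup>2) \<partial>M3) =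
      cmod (\<integral>x. cis (t x + b * (norm x)\<^sup>2) * cis (- 2 * b * (x \<bullet> y)) \<partial>M3)" for t b and y :: 'a
  proof -
    have "cis (t x + b * (norm (x - y))\<^sup>2) = cis (b * (norm y)\<^sup>2) * (cis (t x + b * (norm x)\<^sup>2) * cis (- 2 * b * (x \<bullet> y)))" for x
      by (simp add: cis_mult power2_norm_eq_inner inner_diff_left inner_diff_right inner_commute algebra_simps)
    then show ?thesis by (simp add: norm_mult)
  qed
  have est2: "(\<integral>\<^sup>+x2. \<Phi> a b x1 x2 \<partial>M2) \<le> ennreal (K2 * (2 * \<bar>b\<bar>) powr (- p))" if "\<bar>b\<bar> \<ge> 1" for a b x1
    using K2(2)[of "\<lambda>x. cis (a * (norm (x - x1))\<^sup>2 + b * (norm x)\<^sup>2)" "- 2 * b"] that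
    unfolding \<Phi>_def linearize by (simp add: p_def abs_mult)
  have est1: "(\<integral>\<^sup>+x1. \<Phi> a b x1 x2 \<partial>M1) \<le> ennreal (K1 * (2 * \<bar>a\<bar>) powr (- p))" if "\<bar>a\<bar> \<ge> 1" for a b x2
    using K1(2)[of "\<lambda>x. cis (b * (norm (x - x2))\<^sup>2 + a * (norm x)\<^sup>2)" "- 2 * a"] that
    unfolding \<Phi>_def add.commute[of "a * _"] linearize by (simp add: p_def abs_mult)
  have est0: "\<Phi> a b x1 x2 \<le> ennreal (m3\<^sup>2)" for a b x1 x2
  proof -
    have "cmod (\<integral>x. cis (a * (norm (x - x1))\<^sup>2 + b * (norm (x - x2))\<^sup>2) \<partial>M3) \<le> (\<integral>x. 1 \<partial>M3)"
      by (rule order_trans[OF integral_norm_bound]) simp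
    then show ?thesis unfolding \<Phi>_def m3_def by (intro ennreal_leI power_mono) auto
  qed
  \<comment> \<open>The decay \<open>p\<close> in the larger frequency is shared equally between the
    coordinates; the product is integrable because \<open>p / 2 > 1\<close>, which is where the
    lower bound on \<open>s\<close> enters.\<close>
  define w where "w t = (1 + \<bar>t\<bar>) powr (- (p / 2))" for t :: real
  have w[measurable]: "w \<in> borel_measurable borel" unfolding w_def by measurable
  have w0: "w t \<ge> 0" for t by (simp add: w_def)
  \<comment> \<open>Here \<open>1 + |a| \<le> 2 * t\<close> because \<open>t \<ge> 1\<close>; the
    factor 2 matches the frequencies \<open>- 2 * b\<close> and \<open>- 2 * a\<close> of the
    linearized phases.\<close>
  have ww: "(2 * t) powr (- p) \<le> w a * w b" if "\<bar>a\<bar> \<le> t" "\<bar>b\<bar> \<le> t" "t \<ge> 1" for a b t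
  proof -
    have "(2 * t) powr (- p) = (2 * t) powr (- (p / 2)) * (2 * t) powr (- (p / 2))"
      by (simp flip: powr_add)
    also have "\<dots> \<le> w a * w b"
      unfolding w_def using that p by (intro mult_mono powr_mono2') auto
    finally show ?thesis .
  qed
  \<comment> \<open>One summand for each of the three cases below; \<open>2 powr p\<close>
    compensates for using \<open>ww\<close> at \<open>t = 1\<close> when both frequencies are at
    most 1.\<close>
  define K where "K = m1 * K2 + m2 * K1 + m1 * m2 * m3\<^sup>2 * 2 powr p"
  have est: "(\<integral>\<^sup>+z. \<Phi> a b (fst z) (snd z) \<partial>(M1 \<Otimes>\<^sub>M M2)) \<le> ennreal K * (ennreal (w a) * ennreal (w b))" for a b
  proof -
    have *: "ennreal (u * c) \<le> ennreal K * (ennreal (w a) * ennreal (w b))"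
      if "u \<le> K" "0 \<le> u" "c \<le> w a * w b" "0 \<le> c" for u c
      using that w0 by (subst ennreal_mult[symmetric], simp, simp, subst ennreal_mult[symmetric])
        (auto intro!: ennreal_leI mult_mono)
    have K: "0 \<le> m1 * K2" "0 \<le> m2 * K1" "0 \<le> m1 * m2 * m3\<^sup>2 * 2 powr p"
      using m K1 K2 by auto
    consider "\<bar>a\<bar> \<le> \<bar>b\<bar>" "\<bar>b\<bar> \<ge> 1" | "\<bar>b\<bar> \<le> \<bar>a\<bar>" "\<bar>a\<bar> \<ge> 1" | "\<bar>a\<bar> \<le> 1" "\<bar>b\<bar> \<le> 1" by linarith
    then show ?thesis
    proof cases
      case 1
      have "(\<integral>\<^sup>+z. \<Phi> a b (fst z) (snd z) \<partial>(M1 \<Otimes>\<^sub>M M2)) = (\<integral>\<^sup>+x1. \<integral>\<^sup>+x2. \<Phi> a b x1 x2 \<partial>M2 \<partial>M1)"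
        by (subst M2.nn_integral_fst[symmetric]) auto
      also have "\<dots> \<le> (\<integral>\<^sup>+x1. ennreal (K2 * (2 * \<bar>b\<bar>) powr (- p)) \<partial>M1)"
        by (intro nn_integral_mono est2 1)
      also have "\<dots> = ennreal (m1 * K2 * (2 * \<bar>b\<bar>) powr (- p))"
        using K2(1) by (simp add: M1.emeasure_eq_measure m1_def mult_ac flip: ennreal_mult)
      also have "\<dots> \<le> ennreal K * (ennreal (w a) * ennreal (w b))"
        using 1 K by (intro * ww) (auto simp: K_def)
      finally show ?thesis .
    next
      case 2
      have "(\<integral>\<^sup>+z. \<Phi> a b (fst z) (snd z) \<partial>(M1 \<Otimes>\<^sub>M M2)) = (\<integral>\<^sup>+x2. \<integral>\<^sup>+x1. \<Phi> a b x1 x2 \<partial>M1 \<partial>M2)"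
        by (subst P.nn_integral_snd[symmetric]) auto
      also have "\<dots> \<le> (\<integral>\<^sup>+x2. ennreal (K1 * (2 * \<bar>a\<bar>) powr (- p)) \<partial>M2)"
        by (intro nn_integral_mono est1 2)
      also have "\<dots> = ennreal (m2 * K1 * (2 * \<bar>a\<bar>) powr (- p))"
        using K1(1) by (simp add: M2.emeasure_eq_measure m2_def mult_ac flip: ennreal_mult)
      also have "\<dots> \<le> ennreal K * (ennreal (w a) * ennreal (w b))"
        using 2 K by (intro * ww) (auto simp: K_def)
      finally show ?thesis .
    next
      case 3
      have "(\<integral>\<^sup>+z. \<Phi> a b (fst z) (snd z) \<partial>(M1 \<Otimes>\<^sub>M M2)) = (\<integral>\<^sup>+x1. \<integral>\<^sup>+x2. \<Phi> a b x1 x2 \<partial>M2 \<partial>M1)"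
        by (subst M2.nn_integral_fst[symmetric]) auto
      also have "\<dots> \<le> (\<integral>\<^sup>+x1. \<integral>\<^sup>+x2. ennreal (m3\<^sup>2) \<partial>M2 \<partial>M1)"
        by (intro nn_integral_mono est0)
      also have "\<dots> = ennreal (m1 * m2 * m3\<^sup>2)"
        by (simp add: M1.emeasure_eq_measure M2.emeasure_eq_measure m1_def m2_def mult_ac flip: ennreal_mult)
      also have "\<dots> = ennreal ((m1 * m2 * m3\<^sup>2 * 2 powr p) * (2 * 1) powr (- p))"
        by (simp add: powr_minus mult.assoc)
      also have "\<dots> \<le> ennreal K * (ennreal (w a) * ennreal (w b))"
        using 3 K by (intro * ww) (auto simp: K_def)
      finally show ?thesis .
    qed
  qed
  have wfin: "(\<integral>\<^sup>+t. ennreal (w t) \<partial>lborel) < \<infinity>"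
    unfolding w_def using p by (intro nn_integral_powr_tail_finite) simp
  define I where "I z = (\<integral>\<^sup>+\<zeta>. \<Phi> (fst \<zeta>) (snd \<zeta>) (fst z) (snd z) \<partial>lborel)" for z
  have I[measurable]: "I \<in> borel_measurable (M1 \<Otimes>\<^sub>M M2)"
    unfolding I_def using measurable_pair_swap[OF \<Phi>]
    by (intro lborel.borel_measurable_nn_integral) (simp add: split_beta')
  have "(\<integral>\<^sup>+z. I z \<partial>(M1 \<Otimes>\<^sub>M M2)) = (\<integral>\<^sup>+\<zeta>. \<integral>\<^sup>+z. \<Phi> (fst \<zeta>) (snd \<zeta>) (fst z) (snd z) \<partial>(M1 \<Otimes>\<^sub>M M2) \<partial>lborel)"
    unfolding I_def by (rule Q.Fubini'[of "\<lambda>\<zeta> z. \<Phi> (fst \<zeta>) (snd \<zeta>) (fst z) (snd z)"]) (simp add: split_beta')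
  also have "\<dots> \<le> (\<integral>\<^sup>+\<zeta>. ennreal K * (ennreal (w (fst \<zeta>)) * ennreal (w (snd \<zeta>))) \<partial>lborel)"
    by (intro nn_integral_mono est)
  also have "\<dots> = ennreal K * (\<integral>\<^sup>+\<zeta>. ennreal (w (fst \<zeta>)) * ennreal (w (snd \<zeta>)) \<partial>(lborel \<Otimes>\<^sub>M lborel))"
    by (subst lborel_prod[symmetric], rule nn_integral_cmult) measurable
  also have "(\<integral>\<^sup>+\<zeta>. ennreal (w (fst \<zeta>)) * ennreal (w (snd \<zeta>)) \<partial>(lborel \<Otimes>\<^sub>M lborel)) =
      (\<integral>\<^sup>+t. ennreal (w t) \<partial>lborel) * (\<integral>\<^sup>+t. ennreal (w t) \<partial>lborel)"
    by (subst lborel.nn_integral_fst[symmetric]) (simp_all add: nn_integral_cmult nn_integral_multc)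
  also have "ennreal K * ((\<integral>\<^sup>+t. ennreal (w t) \<partial>lborel) * (\<integral>\<^sup>+t. ennreal (w t) \<partial>lborel)) < \<infinity>"
    using wfin by (simp add: ennreal_mult_less_top)
  finally have "(\<integral>\<^sup>+z. I z \<partial>(M1 \<Otimes>\<^sub>M M2)) \<noteq> \<infinity>" by simp
  from nn_integral_PInf_AE[OF I this]
  show ?thesis
    by eventually_elim (auto simp: I_def \<Phi>_def split_beta' inner_prod_def less_top)
qed

subsection \<open>Square integrable Fourier transforms\<close>

text \<open>The conclusion that an L2 density would give is reached without constructing one: square
  integrability bounds the energy of the image measure at every scale \<open>r\<close>, and
  compactness of \<open>K\<close> permits the limit \<open>r\<close> to 0.\<close>

lemma fourier_L2_emeasure_pos:
  fixes g :: "'b \<Rightarrow> 'a::euclidean_space"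
  assumes M: "finite_measure M" and g[measurable]: "g \<in> borel_measurable M"
    and L2: "(\<integral>\<^sup>+\<xi>. ennreal ((cmod (\<integral>x. cis (\<xi> \<bullet> g x) \<partial>M))\<^sup>2) \<partial>lborel) < \<infinity>"
    and K: "compact K" and gK: "AE x in M. g x \<in> K" and M0: "emeasure M (space M) \<noteq> 0"
  shows "emeasure lborel K > 0"
proof (rule ccontr)
  assume "\<not> emeasure lborel K > 0"
  then have K0: "emeasure lborel K = 0" by simp
  interpret finite_measure M by fact
  define D where "D = DIM('a)"
  define J where "J = enn2real (\<integral>\<^sup>+\<xi>. ennreal ((cmod (\<integral>x. cis (\<xi> \<bullet> g x) \<partial>M))\<^sup>2) \<partial>lborel)"
  have J: "(\<integral>\<^sup>+\<xi>. ennreal ((cmod (\<integral>x. cis (\<xi> \<bullet> g x) \<partial>M))\<^sup>2) \<partial>lborel) = ennreal J" "J \<ge> 0"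
    using L2 by (auto simp: J_def ennreal_enn2real less_top)
  define c where "c = unit_ball_vol (real D)"
  have c: "c > 0" by (simp add: c_def)
  \<comment> \<open>Cauchy-Schwarz for \<open>h p = M {x. dist (g x) p \<le> r}\<close>, which lives on the neighbourhood \<open>V r\<close> of \<open>K\<close>,
    bounds the measure of \<open>V r\<close> from below uniformly in \<open>r\<close>\<close>
  define V where "V r = {p. infdist p K \<le> r}" for r
  have V[measurable]: "V r \<in> sets borel" for r
    unfolding V_def by (intro borel_closed closed_Collect_le continuous_intros)
  have Kne: "K \<noteq> {}"
  proof
    assume "K = {}"
    with gK have "emeasure M (space M) = 0"
      using AE_iff_measurable[of "space M" M "\<lambda>_. False"] by simp
    with M0 show False by simp
  qed
  define m where "m = measure M (space M)"
  have m: "m > 0" using M0 by (simp add: m_def emeasure_eq_measure order_less_le)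
  \<comment> \<open>The factor \<open>exp 2\<close> is the loss in passing from balls to Gaussians:
    points within \<open>r\<close> of a common point are at most \<open>2 * r\<close> apart, and
    \<open>(2 * r)\<^sup>2 / (2 * r\<^sup>2) = 2\<close>.\<close>
  define C where "C = exp 2 * J"
  have key: "ennreal (c * m\<^sup>2) \<le> ennreal C * emeasure lborel (V r)" if r: "r > 0" for r
  proof -
    define h where "h p = emeasure M {x \<in> space M. dist (g x) p \<le> r}" for p
    have heq: "h p = (\<integral>\<^sup>+x. indicator (cball (g x) r) p \<partial>M)" for p
    proof -
      have "(\<integral>\<^sup>+x. indicator (cball (g x) r) p \<partial>M) = (\<integral>\<^sup>+x. indicator {x \<in> space M. dist (g x) p \<le> r} x \<partial>M)"
        by (intro nn_integral_cong) (auto split: split_indicator)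
      also have "\<dots> = h p" unfolding h_def by (rule nn_integral_indicator) measurable
      finally show ?thesis ..
    qed
    interpret P: pair_sigma_finite "lborel :: 'a measure" M ..
    have ind: "(\<lambda>q. indicator (cball (g (snd q)) r) (fst q) :: ennreal) \<in> borel_measurable (lborel \<Otimes>\<^sub>M M)"
      unfolding indicator_def mem_cball by measurable
    have ind1[measurable]: "(\<lambda>x. indicator (cball (g x) r) p :: ennreal) \<in> borel_measurable M" for p
      unfolding indicator_def mem_cball by measurable
    have h[measurable]: "h \<in> borel_measurable borel"
      unfolding heq using ind by (intro borel_measurable_nn_integral) (simp add: split_beta')
    have vol: "emeasure lborel (cball (q::'a) r) = ennreal (c * r ^ D)" for q
      using r by (simp add: emeasure_cball c_def D_def)
    \<comment> \<open>The integral of \<open>h\<close> is known exactly: after exchanging the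
      integrals, every \<open>x\<close> contributes the volume of one ball.\<close>
    have "ennreal (c * r ^ D * m) = (\<integral>\<^sup>+x. emeasure lborel (cball (g x) r) \<partial>M)"
      using c r by (simp add: vol emeasure_eq_measure m_def flip: ennreal_mult)
    also have "\<dots> = (\<integral>\<^sup>+x. \<integral>\<^sup>+p. indicator (cball (g x) r) p \<partial>lborel \<partial>M)"
      by simp
    also have "\<dots> = (\<integral>\<^sup>+p. h p \<partial>lborel)"
      unfolding heq using ind by (intro P.Fubini') (simp add: split_beta')
    also have "\<dots> = (\<integral>\<^sup>+p. indicator (V r) p * h p \<partial>lborel)"
    proof (intro nn_integral_cong)
      fix p
      have "h p = 0" if "p \<notin> V r"
      proof -
        have "AE x in M. \<not> dist (g x) p \<le> r"
          using gK
        proof eventually_elim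
          case (elim x)
          have "infdist p K \<le> dist p (g x)" using elim by (rule infdist_le)
          with that show ?case by (simp add: V_def dist_commute)
        qed
        then show ?thesis
          unfolding h_def by (subst AE_iff_measurable[symmetric, where P="\<lambda>x. \<not> dist (g x) p \<le> r"]) auto
      qed
      then show "h p = indicator (V r) p * h p" by (auto split: split_indicator)
    qed
    finally have "(ennreal (c * r ^ D * m))\<^sup>2 = (\<integral>\<^sup>+p. indicator (V r) p * h p \<partial>lborel)\<^sup>2" by simp
    also have "\<dots> \<le> (\<integral>\<^sup>+p. (indicator (V r) p)\<^sup>2 \<partial>lborel) * (\<integral>\<^sup>+p. (h p)\<^sup>2 \<partial>lborel)"
      by (rule Cauchy_Schwarz_nn_integral) measurable
    also have "(\<integral>\<^sup>+p. (indicator (V r) p)\<^sup>2 \<partial>lborel) = emeasure lborel (V r)"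
    proof -
      have "(\<lambda>p. (indicator (V r) p)\<^sup>2 :: ennreal) = indicator (V r)"
        by (auto split: split_indicator)
      then show ?thesis by simp
    qed
    \<comment> \<open>The square of \<open>h p\<close> measures pairs with both images within
      \<open>r\<close> of \<open>p\<close>. A Gaussian of width \<open>r\<close> dominates them up
      to \<open>exp 2\<close>, and the integral in \<open>p\<close> adds the volume of one
      ball.\<close>
    also have "(\<integral>\<^sup>+p. (h p)\<^sup>2 \<partial>lborel) \<le> ennreal (c * r ^ D * (exp 2 * (r ^ D * J)))"
    proof -
      have "(\<integral>\<^sup>+p. (h p)\<^sup>2 \<partial>lborel) = (\<integral>\<^sup>+p. \<integral>\<^sup>+x. h p * indicator (cball (g x) r) p \<partial>M \<partial>lborel)"
        using ind by (subst nn_integral_cmult) (simp_all add: heq[symmetric] power2_eq_square)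
      also have "\<dots> = (\<integral>\<^sup>+x. \<integral>\<^sup>+p. h p * indicator (cball (g x) r) p \<partial>lborel \<partial>M)"
        using ind by (intro P.Fubini'[symmetric]) (simp add: split_beta')
      also have "\<dots> \<le> (\<integral>\<^sup>+x. ennreal (c * r ^ D * exp 2) * (\<integral>\<^sup>+y. ennreal (exp (- (norm (g x - g y))\<^sup>2 / (2 * r\<^sup>2))) \<partial>M) \<partial>M)"
      proof (intro nn_integral_mono)
        fix x
        let ?e = "\<lambda>y. ennreal (exp (- (norm (g x - g y))\<^sup>2 / (2 * r\<^sup>2)))"
        have "(\<integral>\<^sup>+p. h p * indicator (cball (g x) r) p \<partial>lborel) \<le>
            (\<integral>\<^sup>+p. (ennreal (exp 2) * (\<integral>\<^sup>+y. ?e y \<partial>M)) * indicator (cball (g x) r) p \<partial>lborel)"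
        proof (intro nn_integral_mono)
          fix p
          have "h p \<le> ennreal (exp 2) * (\<integral>\<^sup>+y. ?e y \<partial>M)" if p: "p \<in> cball (g x) r"
          proof -
            have "h p \<le> (\<integral>\<^sup>+y. ennreal (exp 2) * ?e y \<partial>M)"
              unfolding heq
            proof (intro nn_integral_mono)
              fix y
              have "1 \<le> exp 2 * exp (- (norm (g x - g y))\<^sup>2 / (2 * r\<^sup>2))" if y: "p \<in> cball (g y) r"
              proof -
                have "norm (g x - g y) \<le> 2 * r"
                  using p y dist_triangle[of "g x" "g y" p] by (simp add: dist_norm[symmetric] dist_commute)
                then have "(norm (g x - g y))\<^sup>2 \<le> (2 * r)\<^sup>2" by (intro power_mono) auto
                then have "(norm (g x - g y))\<^sup>2 / (2 * r\<^sup>2) \<le> 2"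
                  using r by (simp add: field_simps power2_eq_square)
                then show ?thesis by (simp flip: exp_add)
              qed
              then have "p \<in> cball (g y) r \<Longrightarrow> 1 \<le> ennreal (exp 2) * ?e y"
                by (subst ennreal_mult[symmetric]) auto
              then show "indicator (cball (g y) r) p \<le> ennreal (exp 2) * ?e y"
                by (auto split: split_indicator)
            qed
            then show ?thesis by (subst (asm) nn_integral_cmult) auto
          qed
          then show "h p * indicator (cball (g x) r) p \<le> (ennreal (exp 2) * (\<integral>\<^sup>+y. ?e y \<partial>M)) * indicator (cball (g x) r) p"
            by (auto split: split_indicator)
        qed
        also have "\<dots> = (ennreal (exp 2) * (\<integral>\<^sup>+y. ?e y \<partial>M)) * ennreal (c * r ^ D)"
          by (subst nn_integral_cmult_indicator) (auto simp: vol)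
        also have "\<dots> = ennreal (c * r ^ D * exp 2) * (\<integral>\<^sup>+y. ?e y \<partial>M)"
          using c r by (simp add: ennreal_mult mult_ac)
        finally show "(\<integral>\<^sup>+p. h p * indicator (cball (g x) r) p \<partial>lborel) \<le> ennreal (c * r ^ D * exp 2) * (\<integral>\<^sup>+y. ?e y \<partial>M)" .
      qed
      also have "\<dots> = ennreal (c * r ^ D * exp 2) * (\<integral>\<^sup>+x. \<integral>\<^sup>+y. ennreal (exp (- (norm (g x - g y))\<^sup>2 / (2 * r\<^sup>2))) \<partial>M \<partial>M)"
        by (rule nn_integral_cmult) measurable
      \<comment> \<open>At \<open>a = r\<^sup>2\<close> the prefactor in \<open>gauss_energy\<close>
        is at least \<open>(1 / r) ^ D\<close>.\<close>
      also have "(\<integral>\<^sup>+x. \<integral>\<^sup>+y. ennreal (exp (- (norm (g x - g y))\<^sup>2 / (2 * r\<^sup>2))) \<partial>M \<partial>M) \<le> ennreal (r ^ D * J)"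
      proof -
        let ?E = "(\<integral>\<^sup>+x. \<integral>\<^sup>+y. ennreal (exp (- (norm (g x - g y))\<^sup>2 / (2 * r\<^sup>2))) \<partial>M \<partial>M)"
        have "(1 / r) ^ D \<le> sqrt (2 * pi / r\<^sup>2) ^ D"
        proof (rule power_mono)
          have "1 \<le> 2 * pi" using pi_gt3 by simp
          then have "(1 / r)\<^sup>2 \<le> 2 * pi / r\<^sup>2" using r by (simp add: power_divide divide_right_mono)
          then show "1 / r \<le> sqrt (2 * pi / r\<^sup>2)" by (rule real_le_rsqrt)
        qed (use r in simp)
        then have "ennreal ((1 / r) ^ D) * ?E \<le> ennreal (sqrt (2 * pi / r\<^sup>2) ^ D) * ?E"
          by (intro mult_right_mono ennreal_leI) auto
        also have "\<dots> \<le> ennreal J"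
          using gauss_energy[OF M g, of "r\<^sup>2"] r unfolding D_def J by simp
        finally have "ennreal (r ^ D) * (ennreal ((1 / r) ^ D) * ?E) \<le> ennreal (r ^ D) * ennreal J"
          by (rule mult_left_mono) simp
        moreover have "ennreal (r ^ D) * ennreal ((1 / r) ^ D) = 1"
          using r by (simp add: power_one_over flip: ennreal_mult)
        ultimately show ?thesis using r J by (simp add: mult.assoc[symmetric] ennreal_mult)
      qed
      finally show ?thesis using c r J by (simp add: mult_left_mono mult.assoc flip: ennreal_mult)
    qed
    finally have "ennreal ((c * r ^ D)\<^sup>2 * m\<^sup>2) \<le> emeasure lborel (V r) * ennreal (c * r ^ D * (exp 2 * (r ^ D * J)))"
      using c r m by (simp add: ennreal_power power_mult_distrib mult_left_mono)
    moreover have "ennreal ((c * r ^ D)\<^sup>2 * m\<^sup>2) = ennreal (c * (r ^ D)\<^sup>2) * ennreal (c * m\<^sup>2)"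
      using c by (subst ennreal_mult[symmetric]) (auto simp: power2_eq_square mult_ac)
    moreover have "emeasure lborel (V r) * ennreal (c * r ^ D * (exp 2 * (r ^ D * J))) = ennreal (c * (r ^ D)\<^sup>2) * (ennreal C * emeasure lborel (V r))"
      using c r J by (simp add: C_def power2_eq_square ennreal_mult mult_ac)
    \<comment> \<open>Both sides carry the factor \<open>(r ^ D)\<^sup>2\<close>; cancelling it
      makes the bound uniform in \<open>r\<close>.\<close>
    ultimately have "ennreal (c * (r ^ D)\<^sup>2) * ennreal (c * m\<^sup>2) \<le> ennreal (c * (r ^ D)\<^sup>2) * (ennreal C * emeasure lborel (V r))"
      by simp
    then show ?thesis using c r by (subst (asm) ennreal_mult_le_mult_iff) auto
  qed
  define r where "r n = 1 / real (Suc n)" for n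
  have r: "r n > 0" for n by (simp add: r_def)
  have rdec: "r k \<le> r n" if "n \<le> k" for n k using that by (simp add: r_def frac_le)
  \<comment> \<open>Continuity from above applies because the neighbourhoods of the compact set
    \<open>K\<close> are bounded; their intersection is \<open>K\<close> because \<open>K\<close> is
    closed.\<close>
  have "(\<lambda>n. emeasure lborel (V (r n))) \<longlonglongrightarrow> emeasure lborel (\<Inter>n. V (r n))"
  proof (rule Lim_emeasure_decseq)
    show "decseq (\<lambda>n. V (r n))"
      unfolding decseq_def V_def using rdec by (auto intro: order_trans)
    show "emeasure lborel (V (r n)) \<noteq> \<infinity>" for n
    proof -
      have "bounded (V (r n))"
        unfolding V_def using compact_infdist_le[OF Kne K r] by (rule compact_imp_bounded)
      then have "emeasure lborel (V (r n)) < \<infinity>" by (rule emeasure_bounded_finite)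
      then show ?thesis by simp
    qed
  qed auto
  moreover have "(\<Inter>n. V (r n)) = K"
  proof (intro equalityI subsetI)
    fix p assume "p \<in> (\<Inter>n. V (r n))"
    then have *: "infdist p K \<le> r n" for n by (auto simp: V_def)
    have "infdist p K \<le> 0"
    proof (rule LIMSEQ_le_const)
      show "r \<longlonglongrightarrow> 0" unfolding r_def by real_asymp
      show "\<exists>N. \<forall>n\<ge>N. infdist p K \<le> r n" using * by blast
    qed
    then have "infdist p K = 0" using infdist_nonneg[of p K] by linarith
    then show "p \<in> K"
      using in_closed_iff_infdist_zero[OF compact_imp_closed[OF K] Kne] by blast
  next
    fix p assume "p \<in> K"
    then show "p \<in> (\<Inter>n. V (r n))" using r by (auto simp: V_def less_imp_le)
  qed
  ultimately have "(\<lambda>n. emeasure lborel (V (r n))) \<longlonglongrightarrow> 0" using K0 by simp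
  then have "(\<lambda>n. ennreal C * emeasure lborel (V (r n))) \<longlonglongrightarrow> ennreal C * 0"
    by (intro ennreal_tendsto_cmult) auto
  then have "ennreal (c * m\<^sup>2) \<le> ennreal C * 0"
    by (rule LIMSEQ_le_const) (use key r in blast)
  moreover have "c * m\<^sup>2 > 0" using c m by simp
  ultimately show False by (simp add: ennreal_eq_0_iff)
qed

subsection \<open>Areas of triangles\<close>

text \<open>By the law of cosines \<open>(a + c - b) / 2\<close> is the inner product of the sides
  at \<open>x1\<close>, so this is the Gram formula. The inequality is Cauchy-Schwarz; it makes the
  radicand nonnegative, which is needed to solve for \<open>b\<close>.\<close>

lemma triangle_area_sqdist:
  fixes x1 x2 x3 :: "'a::euclidean_space"
  defines "a \<equiv> (norm (x3 - x1))\<^sup>2" and "b \<equiv> (norm (x3 - x2))\<^sup>2" and "c \<equiv> (norm (x2 - x1))\<^sup>2"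
  shows "triangle_area x1 x2 x3 = sqrt (c * a - ((a + c - b) / 2)\<^sup>2) / 2"
    and "((a + c - b) / 2)\<^sup>2 \<le> c * a"
proof -
  have "x3 - x2 = (x3 - x1) - (x2 - x1)" by simp
  then have "b = a - 2 * ((x2 - x1) \<bullet> (x3 - x1)) + c"
    unfolding a_def b_def c_def power2_norm_eq_inner
    by (simp only: inner_diff_left[of "x3 - x1"] inner_diff_right[of _ "x3 - x1"])
      (simp add: inner_commute)
  then have *: "(a + c - b) / 2 = (x2 - x1) \<bullet> (x3 - x1)" by simp
  show "triangle_area x1 x2 x3 = sqrt (c * a - ((a + c - b) / 2)\<^sup>2) / 2"
    unfolding * triangle_area_gram by (simp add: a_def c_def)
  show "((a + c - b) / 2)\<^sup>2 \<le> c * a"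
    unfolding * using power_mono[OF Cauchy_Schwarz_ineq2[of "x2 - x1" "x3 - x1"], of 2]
    by (simp add: a_def c_def power_mult_distrib)
qed

lemma continuous_on_triangle_area: "continuous_on S (triangle_area x1 x2)"
  unfolding triangle_area_gram[abs_def] by (intro continuous_intros) auto

text \<open>For fixed \<open>a\<close>, an area \<open>z\<close> leaves only the two values
  \<open>a + c\<close> plus or minus \<open>2 * sqrt (c * a - 4 * z\<^sup>2)\<close> for
  \<open>b\<close>. Each slice of \<open>K\<close> thus lies in two differentiable images of a null
  set and one further point, and Fubini applies.\<close>

lemma emeasure_heron_preimage_eq_0:
  fixes c :: real
  assumes K: "compact K" and Z: "negligible Z"
    and KZ: "\<And>a b. (a, b) \<in> K \<Longrightarrow> sqrt (c * a - ((a + c - b) / 2)\<^sup>2) / 2 \<in> Z \<and> ((a + c - b) / 2)\<^sup>2 \<le> c * a"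
  shows "emeasure lborel K = 0"
proof -
  have "emeasure lborel (Pair a -` K) = 0" for a
  proof -
    \<comment> \<open>The inequality is strict because \<open>sqrt\<close> is not differentiable at
      0; where the radicand vanishes, \<open>b = a + c\<close>, a single point.\<close>
    define Z' where "Z' = {z \<in> Z. 4 * z\<^sup>2 < c * a}"
    have "negligible Z'" unfolding Z'_def by (rule negligible_subset[OF Z]) auto
    have neg: "negligible ((\<lambda>z. a + c + k * sqrt (c * a - 4 * z\<^sup>2)) ` Z')" for k
    proof (rule negligible_differentiable_image_negligible[OF order_refl \<open>negligible Z'\<close>])
      show "(\<lambda>z. a + c + k * sqrt (c * a - 4 * z\<^sup>2)) differentiable_on Z'"
        unfolding differentiable_on_def
      proof
        fix z assume "z \<in> Z'"
        then have z: "c * a - 4 * z\<^sup>2 > 0" by (simp add: Z'_def)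
        have "((\<lambda>z. a + c + k * sqrt (c * a - 4 * z\<^sup>2)) has_real_derivative
            k * (inverse (sqrt (c * a - 4 * z\<^sup>2)) / 2 * (- 8 * z))) (at z)"
          using z by (auto intro!: derivative_eq_intros)
        then show "(\<lambda>z. a + c + k * sqrt (c * a - 4 * z\<^sup>2)) differentiable at z within Z'"
          using differentiable_at_withinI real_differentiable_def by blast
      qed
    qed
    have "Pair a -` K \<subseteq> (\<lambda>z. a + c + 2 * sqrt (c * a - 4 * z\<^sup>2)) ` Z' \<union>
        (\<lambda>z. a + c + (- 2) * sqrt (c * a - 4 * z\<^sup>2)) ` Z' \<union> {a + c}" (is "_ \<subseteq> ?U")
    proof
      fix b assume "b \<in> Pair a -` K"
      then have b: "sqrt (c * a - ((a + c - b) / 2)\<^sup>2) / 2 \<in> Z" "((a + c - b) / 2)\<^sup>2 \<le> c * a"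
        using KZ by auto
      define z where "z = sqrt (c * a - ((a + c - b) / 2)\<^sup>2) / 2"
      have z: "c * a - 4 * z\<^sup>2 = ((a + c - b) / 2)\<^sup>2"
        using b(2) by (simp add: z_def power_divide field_simps)
      show "b \<in> ?U"
      proof (cases "b = a + c")
        case False
        then have "((a + c - b) / 2)\<^sup>2 > 0" by simp
        then have "4 * z\<^sup>2 < c * a" using z by linarith
        then have "z \<in> Z'" using b(1) by (simp add: Z'_def z_def[symmetric])
        moreover have "b = a + c + 2 * sqrt (c * a - 4 * z\<^sup>2) \<or> b = a + c + (- 2) * sqrt (c * a - 4 * z\<^sup>2)"
          unfolding z real_sqrt_abs by (auto simp: abs_if field_simps)
        ultimately show ?thesis by blast
      qed simp
    qed
    then have "negligible (Pair a -` K)"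
      by (rule negligible_subset[rotated]) (intro negligible_Un neg negligible_sing)
    \<comment> \<open>A closed slice is Borel, so negligibility becomes measure 0 for
      \<open>lborel\<close>.\<close>
    moreover have "closed (Pair a -` K)"
      using compact_imp_closed[OF K] by (rule closed_vimage) (intro continuous_intros)
    ultimately show ?thesis
      by (simp add: negligible_iff_emeasure0)
  qed
  moreover have "K \<in> sets (lborel \<Otimes>\<^sub>M lborel)"
    unfolding lborel_prod using compact_imp_closed[OF K] by simp
  ultimately have "emeasure (lborel \<Otimes>\<^sub>M lborel) K = 0"
    by (simp add: lborel.emeasure_pair_measure_alt)
  then show ?thesis by (simp add: lborel_prod)
qed

section \<open>Restricted measures, and the passage from pairs of distances to areas\<close>

lemma restr_measure_frostman:
  fixes M :: "'a::euclidean_space measure"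
  assumes "finite_measure M" and sM: "sets M = sets borel" and F: "compact F"
    and C: "\<And>x r. r > 0 \<Longrightarrow> measure M (cball x r) \<le> C * r powr s"
  shows "finite_measure (restr_measure M F)" "sets (restr_measure M F) = sets borel"
    and "r > 0 \<Longrightarrow> measure (restr_measure M F) (cball x r) \<le> C * r powr s"
    and "AE x in restr_measure M F. x \<in> F"
    and "emeasure (restr_measure M F) UNIV = emeasure M F"
proof -
  interpret finite_measure M by fact
  have F[measurable]: "F \<in> sets M" using compact_imp_closed[OF F] sM by simp
  have spM: "space M = UNIV" using sets_eq_imp_space_eq[OF sM] by simp
  show s: "sets (restr_measure M F) = sets borel" by (simp add: restr_measure_def sM)
  show U: "emeasure (restr_measure M F) UNIV = emeasure M F"
    using emeasure_restr_measure[OF F, of UNIV] sM by simp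
  show fin: "finite_measure (restr_measure M F)"
    using U by (intro finite_measureI) (simp add: restr_measure_def spM)
  show "measure (restr_measure M F) (cball x r) \<le> C * r powr s" if "r > 0"
  proof -
    have "measure (restr_measure M F) (cball x r) = measure M (cball x r \<inter> F)"
      unfolding measure_def using sM by (subst emeasure_restr_measure[OF F]) auto
    also have "\<dots> \<le> measure M (cball x r)"
      using sM by (intro finite_measure_mono) auto
    also have "\<dots> \<le> C * r powr s" by (rule C[OF that])
    finally show ?thesis .
  qed
  show "AE x in restr_measure M F. x \<in> F"
    unfolding restr_measure_def by (subst AE_density) (auto simp: indicator_def)
qed

theorem corollary1p3:
  fixes E E1 E2 E3 :: "(real ^ 'd) set"
    and \<mu> :: "(real ^ 'd) measure"
    and s :: real
  assumes "CARD('d) \<ge> 3"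
    and "compact E"
    and "hausdorff_dim E > ereal ((real CARD('d) + 2) / 2)"
    and "frostman_measure s E \<mu>"
    and "s > (real CARD('d) + 2) / 2"
    and "compact E1" "compact E2" "compact E3"
    and "E1 \<subseteq> E" "E2 \<subseteq> E" "E3 \<subseteq> E"
    and "setdist E1 E2 > 0" "setdist E1 E3 > 0" "setdist E2 E3 > 0"
    and "emeasure \<mu> E1 > 0" "emeasure \<mu> E2 > 0" "emeasure \<mu> E3 > 0"
  shows "AE (x1, x2) in restr_measure \<mu> E1 \<Otimes>\<^sub>M restr_measure \<mu> E2.
           (x1, x2) \<in> E1 \<times> E2 \<longrightarrow>
           emeasure lebesgue {triangle_area x1 x2 x3 | x3. x3 \<in> E3} > 0"
proof -
  obtain C where \<mu>: "finite_measure \<mu>" "sets \<mu> = sets borel"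
    and C: "\<And>x r. r > 0 \<Longrightarrow> measure \<mu> (cball x r) \<le> C * r powr s"
    using assms(4) unfolding frostman_measure_def by blast
  obtain R where R: "\<And>x. x \<in> E \<Longrightarrow> norm x \<le> R"
    using compact_imp_bounded[OF \<open>compact E\<close>] unfolding bounded_iff by blast
  have restr: "finite_measure (restr_measure \<mu> F)" "sets (restr_measure \<mu> F) = sets borel"
    "\<And>x r. r > 0 \<Longrightarrow> measure (restr_measure \<mu> F) (cball x r) \<le> C * r powr s"
    "AE x in restr_measure \<mu> F. x \<in> F" "emeasure (restr_measure \<mu> F) UNIV = emeasure \<mu> F"
    if "compact F" for F
    using restr_measure_frostman[OF \<mu> that, of C s] C by blast+
  have supp: "AE x in restr_measure \<mu> F. norm x \<le> R" if "compact F" "F \<subseteq> E" for F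
    using restr(4)[OF that(1)] by eventually_elim (use R that(2) in auto)
  define M3 where "M3 = restr_measure \<mu> E3"
  note M3 = restr[OF \<open>compact E3\<close>, folded M3_def]
  \<comment> \<open>The Frostman constant \<open>C\<close> of \<open>\<mu>\<close> and the radius
    \<open>R\<close> of \<open>E\<close> serve all three restrictions.\<close>
  have "AE (x1, x2) in restr_measure \<mu> E1 \<Otimes>\<^sub>M restr_measure \<mu> E2.
      (\<integral>\<^sup>+\<zeta>. ennreal ((cmod (\<integral>x. cis (\<zeta> \<bullet> ((norm (x - x1))\<^sup>2, (norm (x - x2))\<^sup>2)) \<partial>M3))\<^sup>2) \<partial>lborel) < \<infinity>"
    unfolding M3_def
    using assms(5-11) by (intro pinned_distances_fourier_L2[where s=s and C=C and R=R] restr supp) auto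
  then show ?thesis
  proof eventually_elim
    case (elim z)
    obtain x1 x2 where z: "z = (x1, x2)" by (cases z)
    define g where "g x = ((norm (x - x1))\<^sup>2, (norm (x - x2))\<^sup>2)" for x
    define Z where "Z = triangle_area x1 x2 ` E3"
    have g: "continuous_on S g" for S unfolding g_def by (intro continuous_intros)
    have gK: "compact (g ` E3)" by (rule compact_continuous_image[OF g \<open>compact E3\<close>])
    have "emeasure lborel (g ` E3) > 0"
    proof (rule fourier_L2_emeasure_pos[OF M3(1) _ _ gK])
      show "g \<in> borel_measurable M3"
        using borel_measurable_continuous_onI[OF g] unfolding measurable_cong_sets[OF M3(2) refl] .
      show "(\<integral>\<^sup>+\<xi>. ennreal ((cmod (\<integral>x. cis (\<xi> \<bullet> g x) \<partial>M3))\<^sup>2) \<partial>lborel) < \<infinity>"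
        using elim by (simp add: z g_def)
      show "AE x in M3. g x \<in> g ` E3" using M3(4) by eventually_elim simp
      show "emeasure M3 (space M3) \<noteq> 0"
        using M3(5) sets_eq_imp_space_eq[OF M3(2)] assms(17) by simp
    qed
    \<comment> \<open>For fixed \<open>x1\<close> and \<open>x2\<close>, every point of the image of
      \<open>E3\<close> under \<open>g\<close> has its area in \<open>Z\<close>, with
      \<open>c = (norm (x2 - x1))\<^sup>2\<close>, so a null \<open>Z\<close> would make that image
      null.\<close>
    have "\<not> negligible Z"
    proof
      assume "negligible Z"
      with gK have "emeasure lborel (g ` E3) = 0"
      proof (rule emeasure_heron_preimage_eq_0)
        fix a b assume "(a, b) \<in> g ` E3"
        then obtain x where x: "x \<in> E3" "a = (norm (x - x1))\<^sup>2" "b = (norm (x - x2))\<^sup>2"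
          by (auto simp: g_def)
        show "sqrt ((norm (x2 - x1))\<^sup>2 * a - ((a + (norm (x2 - x1))\<^sup>2 - b) / 2)\<^sup>2) / 2 \<in> Z \<and>
            ((a + (norm (x2 - x1))\<^sup>2 - b) / 2)\<^sup>2 \<le> (norm (x2 - x1))\<^sup>2 * a"
          unfolding x(2,3) triangle_area_sqdist(1)[symmetric] Z_def
          using x(1) triangle_area_sqdist(2) by blast
      qed
      with \<open>emeasure lborel (g ` E3) > 0\<close> show False by simp
    qed
    \<comment> \<open>Since \<open>emeasure\<close> is 0 by default on sets that are not measurable,
      positivity needs measurability of \<open>Z\<close>, which compactness supplies.\<close>
    moreover have "compact Z"
      unfolding Z_def by (rule compact_continuous_image[OF continuous_on_triangle_area \<open>compact E3\<close>])
    then have "Z \<in> sets lebesgue" by (simp add: compact_imp_closed)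
    ultimately have "emeasure lebesgue Z > 0"
      by (simp add: negligible_iff_emeasure0 zero_less_iff_neq_zero)
    moreover have "Z = {triangle_area x1 x2 x3 | x3. x3 \<in> E3}" unfolding Z_def by blast
    ultimately show ?case by (simp add: z)
  qed
qed

end
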